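(* (i) If $(\mathbf u_{hp},\boldsymbol p_{hp})\in V_{hp}\times Q_{hp}$ solves the discrete variational inequality $$a\big((\mathbf u_{hp},\boldsymbol p_{hp}),(\mathbf v_{hp}-\mathbf u_{hp},\boldsymbol q_{hp}-\boldsymbol p_{hp})\big)+\psi_{hp}(\boldsymbol q_{hp})-\psi_{hp}(\boldsymbol p_{hp})\ge \ell(\mathbf v_{hp}-\mathbf u_{hp})\qquad\forall(\mathbf v_{hp},\boldsymbol q_{hp})\in V_{hp}\times Q_{hp},\qquad (\mathrm{VI})$$ then the triple $(\mathbf u_{hp},\boldsymbol p_{hp},\boldsymbol\lambda_{hp})$ with $$\boldsymbol\lambda_{hp}=\mathcal P_{hp}\big(\operatorname{dev}(\boldsymbol\sigma(\mathbf u_{hp},\boldsymbol p_{hp})-\mathbb H\,\boldsymbol p_{hp})\big)\qquad (\mathrm{L})$$ belongs to $V_{hp}\times Q_{hp}\times\Lambda_{hp}^{(w)}$ and solves the discrete mixed problem $$a\big((\mathbf u_{hp},\boldsymbol p_{hp}),(\mathbf v_{hp},\boldsymbol q_{hp})\big)+(\boldsymbol\lambda_{hp},\boldsymbol q_{hp})_{0,\Omega}=\ell(\mathbf v_{hp})\quad\forall(\mathbf v_{hp},\boldsymbol q_{hp})\in V_{hp}\times Q_{hp},$$ $$(\boldsymbol\mu_{hp}-\boldsymbol\lambda_{hp},\boldsymbol p_{hp})_{0,\Omega}\le 0\quad\forall\boldsymbol\mu_{hp}\in\Lambda_{hp}^{(w)}.\qquad (\mathrm{M})$$ (ii) Conversely,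 if $(\mathbf u_{hp},\boldsymbol p_{hp},\boldsymbol\lambda_{hp})\in V_{hp}\times Q_{hp}\times\Lambda_{hp}^{(w)}$ solves the discrete mixed problem (M) (both lines), then $(\mathbf u_{hp},\boldsymbol p_{hp})$ solves (VI) and (L) holds.
   Context: Let $d\in\{2,3\}$ and let $\Omega\subset\mathbb R^d$ be a bounded polygonal (polyhedral) domain with Lipschitz boundary $\Gamma=\partial\Omega$; $\Gamma_D\subseteq\Gamma$ is closed with positive surface measure and $\Gamma_N=\Gamma\setminus\Gamma_D$. Set $V=\{\mathbf v\in H^1(\Omega,\mathbb R^d):\mathbf v|_{\Gamma_D}=0\}$, $\mathbb S_{d,0}=\{\boldsymbol\tau\in\mathbb R^{d\times d}:\boldsymbol\tau=\boldsymbol\tau^\top,\ \operatorname{tr}(\boldsymbol\tau)=0\}$, $Q=L^2(\Omega,\mathbb S_{d,0})$. $(\cdot,\cdot)_{0,\Omega}$ and $\|\cdot\|_{0,\Omega}$ are the $L^2$ inner product and norm (for scalar, vector or matrix valued functions, with the Frobenius product $\boldsymbol p:\boldsymbol q=\sum_{i,j}p_{ij}q_{ij}$, Frobenius norm $|\cdot|_F$). $\boldsymbol\varepsilon(\mathbf v)=\frac12(\nabla\mathbf v+(\nabla\mathbf v)^\top)$; $\operatorname{dev}(\boldsymbol\tau)=\boldsymbol\tau-\frac1d\operatorname{tr}(\boldsymbol\tau)\boldsymbol I$. The elasticity tensor $\mathbb C$ and hardening tensor $\mathbb H$ are (possibly $x$-dependent, measurable) linear maps on symmetric matrices that are symmetric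 with respect to the Frobenius product, uniformly bounded and uniformly elliptic ($\mathbb C\boldsymbol\tau:\boldsymbol\tau\ge c|\boldsymbol\tau|_F^2$, $\mathbb H\boldsymbol\tau:\boldsymbol\tau\ge c|\boldsymbol\tau|_F^2$ a.e. in $\Omega$ for all symmetric $\boldsymbol\tau$ with some $c>0$). $\boldsymbol\sigma(\mathbf u,\boldsymbol p)=\mathbb C(\boldsymbol\varepsilon(\mathbf u)-\boldsymbol p)$ and $a((\mathbf u,\boldsymbol p),(\mathbf v,\boldsymbol q))=(\boldsymbol\sigma(\mathbf u,\boldsymbol p),\boldsymbol\varepsilon(\mathbf v)-\boldsymbol q)_{0,\Omega}+(\mathbb H\boldsymbol p,\boldsymbol q)_{0,\Omega}$. The yield stress $\sigma_y>0$ is a constant. For given $\mathbf f\in V^*$ and $\mathbf g\in H^{-1/2}(\Gamma_N,\mathbb R^d)$ (the dual of the trace space $V|_{\Gamma_N}$), $\ell(\mathbf v)=\langle\mathbf f,\mathbf v\rangle+\langle\mathbf g,\mathbf v\rangle_{\Gamma_N}$. Discretization: $\mathcal T_h$ is a locally quasi-uniform finite element mesh of $\Omega$ of convex, shape regular quadrilaterals ($d=2$) or hexahedra ($d=3$); $\widehat T=[-1,1]^d$; $F_T:\widehat T\to T$ is the bi-/trilinear bijective map, and $\det\nabla F_T$ has no change of sign in $\widehat T$. Each $T$ carries a polynomial degree $p_T\ge1$, comparable on neighboring elements. $\mathbb P_k(\widehat T)$ is the space of polynomials on $\widehat T$ of degree at most $k$ in each variable. $V_{hp}=\{\mathbf v\in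 V:\mathbf v|_T\circ F_T\in(\mathbb P_{p_T}(\widehat T))^d\ \forall T\in\mathcal T_h\}$, $Q_{hp}=\{\boldsymbol q\in Q:\boldsymbol q|_T\circ F_T\in(\mathbb P_{p_T-1}(\widehat T))^{d\times d}\ \forall T\in\mathcal T_h\}$. $\mathcal P_{hp}:Q\to Q_{hp}$ is the $L^2$-projection. With $n_T=p_T^d$, $\hat x_{k,T}$, $1\le k\le n_T$, are the tensor product Gauss quadrature points on $\widehat T$ ($p_T$ points per direction) with positive weights $\hat\omega_{k,T}$. The quadrature rule is $\mathcal Q_{hp}(f)=\sum_{T}\mathcal Q_{hp,T}(f)$ with $\mathcal Q_{hp,T}(f)=|T|\,f(F_T(0))$ if $p_T=1$ and $\mathcal Q_{hp,T}(f)=\sum_{k=1}^{n_T}\hat\omega_{k,T}|\det\nabla F_T(\hat x_{k,T})|\,f(F_T(\hat x_{k,T}))$ if $p_T\ge2$. The discrete plasticity functional is $\psi_{hp}(\boldsymbol q_{hp})=\mathcal Q_{hp}(\sigma_y|\boldsymbol q_{hp}|_F)$, and $\Lambda_{hp}^{(w)}=\{\boldsymbol\mu_{hp}\in Q_{hp}:(\boldsymbol\mu_{hp},\boldsymbol q_{hp})_{0,\Omega}\le\psi_{hp}(\boldsymbol q_{hp})\ \forall\boldsymbol q_{hp}\in Q_{hp}\}$. *)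

theory Defs
  imports "HOL-Analysis.Analysis"
begin

section \<open>Lipschitz polyhedral domains and surface measure\<close>

text \<open>The boundary is locally the graph of a Lipschitz function over the hyperplane orthogonal to
  some unit vector \<open>e\<close>, with \<open>\<Omega>\<close> lying strictly on one side.\<close>

definition lipschitz_boundary :: "(real^'d) set \<Rightarrow> bool" where
  "lipschitz_boundary \<Omega> \<longleftrightarrow>
     (\<forall>x\<in>frontier \<Omega>. \<exists>U e \<gamma> L. open U \<and> x \<in> U \<and> norm e = 1 \<and> L-lipschitz_on UNIV \<gamma> \<and>
        \<Omega> \<inter> U = {y \<in> U. y \<bullet> e > (\<gamma> (y - (y \<bullet> e) *\<^sub>R e) :: real)})"

definition polyhedral_lipschitz_domain :: "(real^'d) set \<Rightarrow> bool" where
  "polyhedral_lipschitz_domain \<Omega> \<longleftrightarrow>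
     open \<Omega> \<and> connected \<Omega> \<and> \<Omega> \<noteq> {} \<and> bounded \<Omega> \<and>
     (\<exists>\<P>. finite \<P> \<and> (\<forall>P\<in>\<P>. polytope P) \<and> closure \<Omega> = \<Union>\<P>) \<and>
     lipschitz_boundary \<Omega>"

text \<open>The \<open>k\<close>-dimensional Hausdorff measure, normalised so as to agree with \<open>k\<close>-dimensional
  Lebesgue measure on \<open>k\<close>-planes. Covering sets have to be bounded, because \<^const>\<open>diameter\<close> is
  unspecified on unbounded sets.\<close>

definition hausdorff_content :: "nat \<Rightarrow> real \<Rightarrow> 'a::metric_space set \<Rightarrow> ennreal" where
  "hausdorff_content k \<delta> A =
     (INF C \<in> {C :: nat \<Rightarrow> 'a set. A \<subseteq> (\<Union>i. C i) \<and> (\<forall>i. bounded (C i) \<and> diameter (C i) \<le> \<delta>)}.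
        \<Sum>i. if C i = {} then 0
             else ennreal (unit_ball_vol (real k) * (diameter (C i) / 2) ^ k))"

definition hausdorff_outer :: "nat \<Rightarrow> 'a::metric_space set \<Rightarrow> ennreal" where
  "hausdorff_outer k A = (SUP \<delta>\<in>{0<..}. hausdorff_content k \<delta> A)"

definition hausdorff_measure :: "nat \<Rightarrow> 'a::metric_space measure" where
  "hausdorff_measure k = measure_of UNIV (sets borel) (hausdorff_outer k)"

definition surface_measure :: "(real^'d) measure" where
  "surface_measure = hausdorff_measure (CARD('d) - 1)"


section \<open>\<open>L\<^sup>2\<close> and \<open>H\<^sup>1\<close>\<close>

text \<open>Elements of function spaces are represented by functions on the whole type of which only the
  values on \<open>\<Omega>\<close> matter. On \<^typ>\<open>real^'d^'d\<close> the library inner product and norm are the Frobenius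
  ones.\<close>

definition L2 :: "(real^'d) set \<Rightarrow> (real^'d \<Rightarrow> 'b::euclidean_space) set" where
  "L2 \<Omega> = {f. f \<in> borel_measurable (lebesgue_on \<Omega>) \<and>
              integrable (lebesgue_on \<Omega>) (\<lambda>x. (norm (f x))\<^sup>2)}"

definition l2_inner ::
    "(real^'d) set \<Rightarrow> (real^'d \<Rightarrow> 'b::euclidean_space) \<Rightarrow> (real^'d \<Rightarrow> 'b) \<Rightarrow> real" where
  "l2_inner \<Omega> f g = (LINT x|lebesgue_on \<Omega>. f x \<bullet> g x)"

definition l2_norm :: "(real^'d) set \<Rightarrow> (real^'d \<Rightarrow> 'b::euclidean_space) \<Rightarrow> real" where
  "l2_norm \<Omega> f = sqrt (l2_inner \<Omega> f f)"

definition l2_projection ::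
    "(real^'d) set \<Rightarrow> (real^'d \<Rightarrow> 'b::euclidean_space) set \<Rightarrow> (real^'d \<Rightarrow> 'b) \<Rightarrow> (real^'d \<Rightarrow> 'b)" where
  "l2_projection \<Omega> S f = (SOME g. g \<in> S \<and> (\<forall>r\<in>S. l2_inner \<Omega> (\<lambda>x. f x - g x) r = 0))"

primrec continuously_differentiable ::
    "nat \<Rightarrow> (real^'d \<Rightarrow> 'b::real_normed_vector) \<Rightarrow> bool" where
  "continuously_differentiable 0 f \<longleftrightarrow> continuous_on UNIV f"
| "continuously_differentiable (Suc k) f \<longleftrightarrow>
     (\<forall>x. f differentiable (at x)) \<and>
     (\<forall>j. continuously_differentiable k (\<lambda>x. frechet_derivative f (at x) (axis j 1)))"

definition smooth :: "(real^'d \<Rightarrow> 'b::real_normed_vector) \<Rightarrow> bool" where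
  "smooth f \<longleftrightarrow> (\<forall>k. continuously_differentiable k f)"

definition test_function :: "(real^'d) set \<Rightarrow> (real^'d \<Rightarrow> real) \<Rightarrow> bool" where
  "test_function \<Omega> \<phi> \<longleftrightarrow> smooth \<phi> \<and> (\<exists>K. compact K \<and> K \<subseteq> \<Omega> \<and> (\<forall>x. x \<notin> K \<longrightarrow> \<phi> x = 0))"

text \<open>The entry \<open>G x $ i $ j\<close> is the weak partial derivative of the component \<open>v\<^sub>i\<close> in direction \<open>j\<close>,
  as in \<^const>\<open>jacobian\<close>.\<close>

definition is_weak_grad ::
    "(real^'d) set \<Rightarrow> (real^'d \<Rightarrow> real^'d) \<Rightarrow> (real^'d \<Rightarrow> real^'d^'d) \<Rightarrow> bool" where
  "is_weak_grad \<Omega> v G \<longleftrightarrow>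
     (\<forall>\<phi> i j. test_function \<Omega> \<phi> \<longrightarrow>
        (LINT x|lebesgue_on \<Omega>. v x $ i * frechet_derivative \<phi> (at x) (axis j 1))
        = - (LINT x|lebesgue_on \<Omega>. G x $ i $ j * \<phi> x))"

definition H1 :: "(real^'d) set \<Rightarrow> (real^'d \<Rightarrow> real^'d) set" where
  "H1 \<Omega> = {v \<in> L2 \<Omega>. \<exists>G\<in>L2 \<Omega>. is_weak_grad \<Omega> v G}"

definition weak_grad :: "(real^'d) set \<Rightarrow> (real^'d \<Rightarrow> real^'d) \<Rightarrow> (real^'d \<Rightarrow> real^'d^'d)" where
  "weak_grad \<Omega> v = (SOME G. G \<in> L2 \<Omega> \<and> is_weak_grad \<Omega> v G)"

definition h1_norm :: "(real^'d) set \<Rightarrow> (real^'d \<Rightarrow> real^'d) \<Rightarrow> real" where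
  "h1_norm \<Omega> v = sqrt ((l2_norm \<Omega> v)\<^sup>2 + (l2_norm \<Omega> (weak_grad \<Omega> v))\<^sup>2)"

text \<open>The trace operator is the continuous extension, from \<open>H\<^sup>1(\<Omega>)\<close> to \<open>L\<^sup>2(\<partial>\<Omega>)\<close>, of the restriction to
  \<open>\<partial>\<Omega>\<close> of functions smooth up to the boundary: \<open>w\<close> is the trace of \<open>v\<close> if some sequence of smooth
  functions tends to \<open>v\<close> in \<open>H\<^sup>1(\<Omega>)\<close> and to \<open>w\<close> in \<open>L\<^sup>2(\<partial>\<Omega>)\<close>.\<close>

definition has_trace ::
    "(real^'d) set \<Rightarrow> (real^'d \<Rightarrow> real^'d) \<Rightarrow> (real^'d \<Rightarrow> real^'d) \<Rightarrow> bool" where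
  "has_trace \<Omega> v w \<longleftrightarrow>
     w \<in> borel_measurable borel \<and>
     (\<integral>\<^sup>+x\<in>frontier \<Omega>. ennreal ((norm (w x))\<^sup>2) \<partial>surface_measure) < \<infinity> \<and>
     (\<exists>\<phi> :: nat \<Rightarrow> real^'d \<Rightarrow> real^'d.
        (\<forall>n. smooth (\<phi> n)) \<and>
        (\<lambda>n. l2_norm \<Omega> (\<lambda>x. \<phi> n x - v x)) \<longlonglongrightarrow> 0 \<and>
        (\<lambda>n. l2_norm \<Omega> (\<lambda>x. jacobian (\<phi> n) (at x) - weak_grad \<Omega> v x)) \<longlonglongrightarrow> 0 \<and>
        (\<lambda>n. \<integral>\<^sup>+x\<in>frontier \<Omega>. ennreal ((norm (\<phi> n x - w x))\<^sup>2) \<partial>surface_measure) \<longlonglongrightarrow> 0)"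

definition boundary_trace :: "(real^'d) set \<Rightarrow> (real^'d \<Rightarrow> real^'d) \<Rightarrow> (real^'d \<Rightarrow> real^'d)" where
  "boundary_trace \<Omega> v = (SOME w. has_trace \<Omega> v w)"

definition V_space :: "(real^'d) set \<Rightarrow> (real^'d) set \<Rightarrow> (real^'d \<Rightarrow> real^'d) set" where
  "V_space \<Omega> \<Gamma>D =
     {v \<in> H1 \<Omega>. \<exists>w. has_trace \<Omega> v w \<and> (AE x in surface_measure. x \<in> \<Gamma>D \<longrightarrow> w x = 0)}"

text \<open>The trace space \<open>V|\<^bsub>\<Gamma>\<^sub>N\<^esub>\<close> with its quotient norm; \<open>\<Gamma>\<^sub>N = frontier \<Omega> - \<Gamma>D\<close>.\<close>

definition trace_on ::
    "(real^'d) set \<Rightarrow> (real^'d) set \<Rightarrow> (real^'d \<Rightarrow> real^'d) \<Rightarrow> (real^'d \<Rightarrow> real^'d) \<Rightarrow> bool" where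
  "trace_on \<Omega> \<Gamma>N v w \<longleftrightarrow>
     (\<exists>w'. has_trace \<Omega> v w' \<and> (AE x in surface_measure. x \<in> \<Gamma>N \<longrightarrow> w x = w' x))"

definition trace_space :: "(real^'d) set \<Rightarrow> (real^'d) set \<Rightarrow> (real^'d \<Rightarrow> real^'d) set" where
  "trace_space \<Omega> \<Gamma>D = {w. \<exists>v\<in>V_space \<Omega> \<Gamma>D. trace_on \<Omega> (frontier \<Omega> - \<Gamma>D) v w}"

definition trace_norm :: "(real^'d) set \<Rightarrow> (real^'d) set \<Rightarrow> (real^'d \<Rightarrow> real^'d) \<Rightarrow> real" where
  "trace_norm \<Omega> \<Gamma>D w =
     Inf (h1_norm \<Omega> ` {v \<in> V_space \<Omega> \<Gamma>D. trace_on \<Omega> (frontier \<Omega> - \<Gamma>D) v w})"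

text \<open>Boundedness with respect to the (semi)norm \<open>N\<close> together with linearity makes such functionals
  insensitive to changes of representatives on null sets.\<close>

definition bounded_functional ::
    "('a \<Rightarrow> 'b::real_vector) set \<Rightarrow> (('a \<Rightarrow> 'b) \<Rightarrow> real) \<Rightarrow> (('a \<Rightarrow> 'b) \<Rightarrow> real) \<Rightarrow> bool" where
  "bounded_functional S N f \<longleftrightarrow>
     (\<forall>v\<in>S. \<forall>w\<in>S. f (\<lambda>x. v x + w x) = f v + f w) \<and>
     (\<forall>c. \<forall>v\<in>S. f (\<lambda>x. c *\<^sub>R v x) = c * f v) \<and>
     (\<exists>B. \<forall>v\<in>S. \<bar>f v\<bar> \<le> B * N v)"

definition load ::
    "(real^'d) set \<Rightarrow> ((real^'d \<Rightarrow> real^'d) \<Rightarrow> real) \<Rightarrow> ((real^'d \<Rightarrow> real^'d) \<Rightarrow> real) \<Rightarrow>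
     (real^'d \<Rightarrow> real^'d) \<Rightarrow> real" where
  "load \<Omega> f g v = f v + g (boundary_trace \<Omega> v)"


section \<open>Elastoplasticity\<close>

definition sym_matrices :: "(real^'d^'d) set" where
  "sym_matrices = {\<tau>. transpose \<tau> = \<tau>}"

definition dev :: "real^'d^'d \<Rightarrow> real^'d^'d" where
  "dev \<tau> = \<tau> - (trace \<tau> / real CARD('d)) *\<^sub>R mat 1"

definition Q_space :: "(real^'d) set \<Rightarrow> (real^'d \<Rightarrow> real^'d^'d) set" where
  "Q_space \<Omega> = {q \<in> L2 \<Omega>. \<forall>x\<in>\<Omega>. q x \<in> sym_matrices \<and> trace (q x) = 0}"

definition strain :: "(real^'d) set \<Rightarrow> (real^'d \<Rightarrow> real^'d) \<Rightarrow> (real^'d \<Rightarrow> real^'d^'d)" where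
  "strain \<Omega> v x = (1/2) *\<^sub>R (weak_grad \<Omega> v x + transpose (weak_grad \<Omega> v x))"

text \<open>A material tensor acts on symmetric matrices only; its values elsewhere are irrelevant.\<close>

definition material_tensor :: "(real^'d) set \<Rightarrow> (real^'d \<Rightarrow> real^'d^'d \<Rightarrow> real^'d^'d) \<Rightarrow> bool" where
  "material_tensor \<Omega> A \<longleftrightarrow>
     (\<forall>x\<in>\<Omega>.
        (\<forall>\<tau>\<in>sym_matrices. A x \<tau> \<in> sym_matrices) \<and>
        (\<forall>\<tau>\<in>sym_matrices. \<forall>\<rho>\<in>sym_matrices. A x (\<tau> + \<rho>) = A x \<tau> + A x \<rho>) \<and>
        (\<forall>c. \<forall>\<tau>\<in>sym_matrices. A x (c *\<^sub>R \<tau>) = c *\<^sub>R A x \<tau>) \<and>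
        (\<forall>\<tau>\<in>sym_matrices. \<forall>\<rho>\<in>sym_matrices. A x \<tau> \<bullet> \<rho> = \<tau> \<bullet> A x \<rho>)) \<and>
     (\<forall>\<tau>\<in>sym_matrices. (\<lambda>x. A x \<tau>) \<in> borel_measurable (lebesgue_on \<Omega>)) \<and>
     (\<exists>M. AE x in lebesgue_on \<Omega>. \<forall>\<tau>\<in>sym_matrices. norm (A x \<tau>) \<le> M * norm \<tau>) \<and>
     (\<exists>c>0. AE x in lebesgue_on \<Omega>. \<forall>\<tau>\<in>sym_matrices. A x \<tau> \<bullet> \<tau> \<ge> c * (norm \<tau>)\<^sup>2)"

definition stress ::
    "(real^'d) set \<Rightarrow> (real^'d \<Rightarrow> real^'d^'d \<Rightarrow> real^'d^'d) \<Rightarrow>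
     (real^'d \<Rightarrow> real^'d) \<Rightarrow> (real^'d \<Rightarrow> real^'d^'d) \<Rightarrow> (real^'d \<Rightarrow> real^'d^'d)" where
  "stress \<Omega> \<C> u p x = \<C> x (strain \<Omega> u x - p x)"

definition bilinear_a ::
    "(real^'d) set \<Rightarrow> (real^'d \<Rightarrow> real^'d^'d \<Rightarrow> real^'d^'d) \<Rightarrow>
     (real^'d \<Rightarrow> real^'d^'d \<Rightarrow> real^'d^'d) \<Rightarrow>
     (real^'d \<Rightarrow> real^'d) \<times> (real^'d \<Rightarrow> real^'d^'d) \<Rightarrow>
     (real^'d \<Rightarrow> real^'d) \<times> (real^'d \<Rightarrow> real^'d^'d) \<Rightarrow> real" where
  "bilinear_a \<Omega> \<C> \<H> = (\<lambda>(u, p) (v, q).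
     l2_inner \<Omega> (stress \<Omega> \<C> u p) (\<lambda>x. strain \<Omega> v x - q x) + l2_inner \<Omega> (\<lambda>x. \<H> x (p x)) q)"


section \<open>Meshes and discrete spaces\<close>

definition ref_cube :: "(real^'d) set" where
  "ref_cube = cbox (-1) 1"

definition poly_space :: "nat \<Rightarrow> (real^'d \<Rightarrow> 'b::real_vector) set" where
  "poly_space k = {P. \<exists>c :: ('d \<Rightarrow> nat) \<Rightarrow> 'b.
     P = (\<lambda>x. \<Sum>\<alpha>\<in>{\<alpha>. \<forall>i. \<alpha> i \<le> k}. (\<Prod>i\<in>UNIV. x $ i ^ \<alpha> i) *\<^sub>R c \<alpha>)}"

text \<open>A convex quadrilateral or hexahedron \<open>T\<close> with its bi- or trilinear parametrisation. The vertices
  of \<open>T\<close> are precisely the images of the vertices of the reference cube.\<close>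

definition mesh_element :: "(real^'d) set \<Rightarrow> (real^'d \<Rightarrow> real^'d) \<Rightarrow> bool" where
  "mesh_element T FT \<longleftrightarrow>
     convex T \<and> FT \<in> poly_space 1 \<and> bij_betw FT ref_cube T \<and>
     {v. v extreme_point_of T} = FT ` {x. \<forall>i. x $ i = -1 \<or> x $ i = 1} \<and>
     ((\<forall>x\<in>ref_cube. det (jacobian FT (at x)) \<ge> 0) \<or> (\<forall>x\<in>ref_cube. det (jacobian FT (at x)) \<le> 0))"

text \<open>The constant \<open>\<kappa>\<close> controls shape regularity (diameter against inscribed ball), local
  quasi-uniformity and the comparability of polynomial degrees on neighbouring elements.\<close>

definition hp_mesh ::
    "real \<Rightarrow> (real^'d) set \<Rightarrow> (real^'d) set set \<Rightarrow> ((real^'d) set \<Rightarrow> real^'d \<Rightarrow> real^'d) \<Rightarrow>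
     ((real^'d) set \<Rightarrow> nat) \<Rightarrow> bool" where
  "hp_mesh \<kappa> \<Omega> \<T> F deg \<longleftrightarrow>
     finite \<T> \<and> \<Union>\<T> = closure \<Omega> \<and>
     pairwise (\<lambda>S T. interior S \<inter> interior T = {}) \<T> \<and>
     (\<forall>T\<in>\<T>. mesh_element T (F T) \<and> deg T \<ge> 1 \<and>
        (\<exists>x r. r > 0 \<and> ball x r \<subseteq> T \<and> diameter T \<le> \<kappa> * r)) \<and>
     (\<forall>S\<in>\<T>. \<forall>T\<in>\<T>. S \<inter> T \<noteq> {} \<longrightarrow>
        diameter S \<le> \<kappa> * diameter T \<and> real (deg S) \<le> \<kappa> * real (deg T))"

text \<open>The polynomial representation is required on the interior of each element only, so that
  discrete functions may jump across element boundaries.\<close>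

definition piecewise_poly ::
    "(real^'d) set set \<Rightarrow> ((real^'d) set \<Rightarrow> real^'d \<Rightarrow> real^'d) \<Rightarrow> ((real^'d) set \<Rightarrow> nat) \<Rightarrow>
     (real^'d \<Rightarrow> 'b::real_vector) \<Rightarrow> bool" where
  "piecewise_poly \<T> F k v \<longleftrightarrow>
     (\<forall>T\<in>\<T>. \<exists>P\<in>poly_space (k T). \<forall>x\<in>interior ref_cube. v (F T x) = P x)"

definition V_hp ::
    "(real^'d) set \<Rightarrow> (real^'d) set \<Rightarrow> (real^'d) set set \<Rightarrow>
     ((real^'d) set \<Rightarrow> real^'d \<Rightarrow> real^'d) \<Rightarrow> ((real^'d) set \<Rightarrow> nat) \<Rightarrow> (real^'d \<Rightarrow> real^'d) set" where
  "V_hp \<Omega> \<Gamma>D \<T> F deg = {v \<in> V_space \<Omega> \<Gamma>D. piecewise_poly \<T> F deg v}"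

definition Q_hp ::
    "(real^'d) set \<Rightarrow> (real^'d) set set \<Rightarrow>
     ((real^'d) set \<Rightarrow> real^'d \<Rightarrow> real^'d) \<Rightarrow> ((real^'d) set \<Rightarrow> nat) \<Rightarrow> (real^'d \<Rightarrow> real^'d^'d) set" where
  "Q_hp \<Omega> \<T> F deg = {q \<in> Q_space \<Omega>. piecewise_poly \<T> F (\<lambda>T. deg T - 1) q}"


section \<open>Quadrature\<close>

text \<open>The \<open>n\<close>-point Gauss rule on \<open>[-1,1]\<close>, that is, the \<open>n\<close>-point rule that is exact up to degree
  \<open>2n - 1\<close>; this determines the nodes and weights up to order.\<close>

definition gauss_rule :: "nat \<Rightarrow> (nat \<Rightarrow> real) \<Rightarrow> (nat \<Rightarrow> real) \<Rightarrow> bool" where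
  "gauss_rule n \<xi> \<omega> \<longleftrightarrow>
     inj_on \<xi> {..<n} \<and> (\<forall>k<n. \<xi> k \<in> {-1..1} \<and> \<omega> k > 0) \<and>
     (\<forall>P :: real poly. degree P \<le> 2 * n - 1 \<longrightarrow>
        (\<Sum>k<n. \<omega> k * poly P (\<xi> k)) = integral {-1..1} (poly P))"

text \<open>Here \<open>\<xi> n\<close> and \<open>\<omega> n\<close> are the nodes and weights of the one-dimensional \<open>n\<close>-point Gauss rule. The
  points of the tensor product rule are indexed by multi-indices with entries below \<open>n\<close>.\<close>

definition quadrature_elem ::
    "(nat \<Rightarrow> nat \<Rightarrow> real) \<Rightarrow> (nat \<Rightarrow> nat \<Rightarrow> real) \<Rightarrow> (real^'d) set \<Rightarrow> (real^'d \<Rightarrow> real^'d) \<Rightarrow> nat \<Rightarrow>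
     (real^'d \<Rightarrow> real) \<Rightarrow> real" where
  "quadrature_elem \<xi> \<omega> T FT n f =
     (if n = 1 then measure lebesgue T * f (FT 0)
      else \<Sum>k\<in>{k :: 'd \<Rightarrow> nat. \<forall>i. k i < n}.
        (let x = (\<chi> i. \<xi> n (k i))
         in (\<Prod>i\<in>UNIV. \<omega> n (k i)) * \<bar>det (jacobian FT (at x))\<bar> * f (FT x)))"

definition psi_hp ::
    "(real^'d) set set \<Rightarrow> ((real^'d) set \<Rightarrow> real^'d \<Rightarrow> real^'d) \<Rightarrow> ((real^'d) set \<Rightarrow> nat) \<Rightarrow>
     (nat \<Rightarrow> nat \<Rightarrow> real) \<Rightarrow> (nat \<Rightarrow> nat \<Rightarrow> real) \<Rightarrow> real \<Rightarrow> (real^'d \<Rightarrow> real^'d^'d) \<Rightarrow> real" where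
  "psi_hp \<T> F deg \<xi> \<omega> \<sigma>y q =
     (\<Sum>T\<in>\<T>. quadrature_elem \<xi> \<omega> T (F T) (deg T) (\<lambda>x. \<sigma>y * norm (q x)))"


section \<open>The discrete problems\<close>

definition Lambda_hp ::
    "(real^'d) set \<Rightarrow> (real^'d \<Rightarrow> real^'d^'d) set \<Rightarrow> ((real^'d \<Rightarrow> real^'d^'d) \<Rightarrow> real) \<Rightarrow>
     (real^'d \<Rightarrow> real^'d^'d) set" where
  "Lambda_hp \<Omega> Qh \<psi> = {\<mu> \<in> Qh. \<forall>q\<in>Qh. l2_inner \<Omega> \<mu> q \<le> \<psi> q}"

definition solves_VI ::
    "((real^'d \<Rightarrow> real^'d) \<times> (real^'d \<Rightarrow> real^'d^'d) \<Rightarrow>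
       (real^'d \<Rightarrow> real^'d) \<times> (real^'d \<Rightarrow> real^'d^'d) \<Rightarrow> real) \<Rightarrow>
     ((real^'d \<Rightarrow> real^'d) \<Rightarrow> real) \<Rightarrow> ((real^'d \<Rightarrow> real^'d^'d) \<Rightarrow> real) \<Rightarrow>
     (real^'d \<Rightarrow> real^'d) set \<Rightarrow> (real^'d \<Rightarrow> real^'d^'d) set \<Rightarrow>
     (real^'d \<Rightarrow> real^'d) \<Rightarrow> (real^'d \<Rightarrow> real^'d^'d) \<Rightarrow> bool" where
  "solves_VI a l \<psi> Vh Qh u p \<longleftrightarrow>
     u \<in> Vh \<and> p \<in> Qh \<and>
     (\<forall>v\<in>Vh. \<forall>q\<in>Qh.
        a (u, p) (\<lambda>x. v x - u x, \<lambda>x. q x - p x) + \<psi> q - \<psi> p \<ge> l (\<lambda>x. v x - u x))"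

definition solves_mixed ::
    "(real^'d) set \<Rightarrow>
     ((real^'d \<Rightarrow> real^'d) \<times> (real^'d \<Rightarrow> real^'d^'d) \<Rightarrow>
       (real^'d \<Rightarrow> real^'d) \<times> (real^'d \<Rightarrow> real^'d^'d) \<Rightarrow> real) \<Rightarrow>
     ((real^'d \<Rightarrow> real^'d) \<Rightarrow> real) \<Rightarrow>
     (real^'d \<Rightarrow> real^'d) set \<Rightarrow> (real^'d \<Rightarrow> real^'d^'d) set \<Rightarrow> (real^'d \<Rightarrow> real^'d^'d) set \<Rightarrow>
     (real^'d \<Rightarrow> real^'d) \<Rightarrow> (real^'d \<Rightarrow> real^'d^'d) \<Rightarrow> (real^'d \<Rightarrow> real^'d^'d) \<Rightarrow> bool" where
  "solves_mixed \<Omega> a l Vh Qh \<Lambda> u p lam \<longleftrightarrow>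
     u \<in> Vh \<and> p \<in> Qh \<and> lam \<in> \<Lambda> \<and>
     (\<forall>v\<in>Vh. \<forall>q\<in>Qh. a (u, p) (v, q) + l2_inner \<Omega> lam q = l v) \<and>
     (\<forall>\<mu>\<in>\<Lambda>. l2_inner \<Omega> (\<lambda>x. \<mu> x - lam x) p \<le> 0)"

end

theory Submission
  imports Defs
begin

text \<open>
The theorem is convex duality in the finite-dimensional space \<open>Q_hp\<close>. Because plastic strains are trace
free,
\<open>a ((u, p), (v, q)) = (\<sigma>(u, p), \<epsilon>(v)) - (dev (\<sigma>(u, p) - \<H> p), q)\<close>, and for discrete \<open>q\<close> the last term is
\<open>(L, q)\<close> with the projected multiplier \<open>L\<close> (\<open>bilinear_a_decomposition\<close>, \<open>l2_projection_Q_hp\<close>). The variational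
inequality therefore splits into the equation \<open>(\<sigma>(u, p), \<epsilon>(v)) = \<ell>(v)\<close> and
\<open>(L, q - p) \<le> \<psi>(q) - \<psi>(p)\<close> for all \<open>q\<close>. As \<open>\<psi>\<close> is positively homogeneous, the latter means that
\<open>(L, q) \<le> \<psi>(q)\<close> for all \<open>q\<close> and \<open>(L, p) = \<psi>(p)\<close>; that is, \<open>L\<close> lies in the set of admissible multipliers and
maximises \<open>(\<mu>, p)\<close> there. This is the mixed problem.

For the converse, the mixed equation with \<open>v = 0\<close> identifies the multiplier with \<open>L\<close>. Recovering
\<open>(L, p) = \<psi>(p)\<close> from maximality requires an admissible \<open>\<mu>\<close> with \<open>(\<mu>, p) = \<psi>(p)\<close>. Since \<open>\<psi>\<close> is a
weighted sum of norms of point values, the functional obtained by replacing each norm by the inner product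
with the normalised value of \<open>p\<close> is a subgradient, and \<open>\<mu>\<close> represents it
(\<open>Lambda_hp_attains_psi_hp\<close>).

This outline rests on three pieces of analysis.

Representation in \<open>Q_hp\<close>, where elements are functions and the inner product is semidefinite. The Gauss nodes
are interior (\<open>gauss_node_interior\<close>). Point values there are unaffected by null sets
(\<open>piecewise_poly_null_imp_zero\<close>) and determine a discrete function up to a null set
(\<open>piecewise_poly_null_if_zero_on_grids\<close>). This yields both the projection and \<open>\<mu>\<close> by
\<open>riesz_representation_finitely_determined\<close>.

Linearity of the strain. A weak gradient is unique almost everywhere (\<open>is_weak_grad_unique\<close>) by the fundamental
lemma of the calculus of variations, for which bump functions are built from \<open>exp (- (1 / x))\<close>.

Homogeneity of the load. A trace is an arbitrary choice, but a functional that is bounded in the quotient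
norm of the trace space has the same value on all traces of a function (\<open>trace_functional_well_defined\<close>).
\<close>

section \<open>Square integrable functions\<close>

lemma L2_measurable: "f \<in> L2 \<Omega> \<Longrightarrow> f \<in> borel_measurable (lebesgue_on \<Omega>)"
  by (simp add: L2_def)

lemma integrable_inner_L2:
  assumes "f \<in> L2 \<Omega>" "g \<in> L2 \<Omega>"
  shows "integrable (lebesgue_on \<Omega>) (\<lambda>x. f x \<bullet> g x)"
proof (rule Bochner_Integration.integrable_bound)
  show "integrable (lebesgue_on \<Omega>) (\<lambda>x. (norm (f x))\<^sup>2 + (norm (g x))\<^sup>2)"
    using assms by (simp add: L2_def)
  show "(\<lambda>x. f x \<bullet> g x) \<in> borel_measurable (lebesgue_on \<Omega>)"
    using assms by (intro borel_measurable_inner L2_measurable)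
  have "norm (a \<bullet> b) \<le> norm ((norm a)\<^sup>2 + (norm b)\<^sup>2)" for a b :: 'b
  proof -
    have "\<bar>a \<bullet> b\<bar> \<le> norm a * norm b"
      by (rule Cauchy_Schwarz_ineq2)
    also have "\<dots> \<le> (norm a)\<^sup>2 + (norm b)\<^sup>2"
      using sum_squares_bound[of "norm a" "norm b"] mult_nonneg_nonneg[of "norm a" "norm b"]
      by (simp del: mult_nonneg_nonneg)
    finally show ?thesis by simp
  qed
  then show "AE x in lebesgue_on \<Omega>. norm (f x \<bullet> g x) \<le> norm ((norm (f x))\<^sup>2 + (norm (g x))\<^sup>2)"
    by simp
qed

lemma L2I_dominated:
  assumes "f \<in> borel_measurable (lebesgue_on \<Omega>)" "g \<in> L2 \<Omega>"
    and "AE x in lebesgue_on \<Omega>. norm (f x) \<le> B * norm (g x)"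
  shows "f \<in> L2 \<Omega>"
proof -
  have "integrable (lebesgue_on \<Omega>) (\<lambda>x. (norm (f x))\<^sup>2)"
  proof (rule Bochner_Integration.integrable_bound)
    show "integrable (lebesgue_on \<Omega>) (\<lambda>x. B\<^sup>2 * (norm (g x))\<^sup>2)"
      using assms by (simp add: L2_def)
    show "(\<lambda>x. (norm (f x))\<^sup>2) \<in> borel_measurable (lebesgue_on \<Omega>)"
      using assms by measurable
    show "AE x in lebesgue_on \<Omega>. norm ((norm (f x))\<^sup>2) \<le> norm (B\<^sup>2 * (norm (g x))\<^sup>2)"
      using assms(3)
    proof (eventually_elim)
      case (elim x)
      then have "(norm (f x))\<^sup>2 \<le> (B * norm (g x))\<^sup>2"
        by (rule power_mono) simp
      then show ?case by (simp add: power_mult_distrib)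
    qed
  qed
  with assms show ?thesis by (simp add: L2_def)
qed

lemma L2_scaleR: "f \<in> L2 \<Omega> \<Longrightarrow> (\<lambda>x. c *\<^sub>R f x) \<in> L2 \<Omega>"
  by (rule L2I_dominated[where B = "\<bar>c\<bar>" and g = f]) (auto dest: L2_measurable)

lemma norm_add_square_le: "(norm (a + b :: 'a::real_normed_vector))\<^sup>2 \<le> 2 * (norm a)\<^sup>2 + 2 * (norm b)\<^sup>2"
proof -
  have "(norm (a + b))\<^sup>2 \<le> (norm a + norm b)\<^sup>2"
    by (rule power_mono[OF norm_triangle_ineq]) simp
  also have "\<dots> \<le> 2 * (norm a)\<^sup>2 + 2 * (norm b)\<^sup>2"
    using sum_squares_bound[of "norm a" "norm b"] by (simp add: power2_sum)
  finally show ?thesis .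
qed

lemma L2_add:
  assumes "f \<in> L2 \<Omega>" "g \<in> L2 \<Omega>"
  shows "(\<lambda>x. f x + g x) \<in> L2 \<Omega>"
proof -
  have m: "(\<lambda>x. f x + g x) \<in> borel_measurable (lebesgue_on \<Omega>)"
    using assms by (intro borel_measurable_add L2_measurable)
  have "integrable (lebesgue_on \<Omega>) (\<lambda>x. (norm (f x + g x))\<^sup>2)"
  proof (rule Bochner_Integration.integrable_bound)
    show "integrable (lebesgue_on \<Omega>) (\<lambda>x. 2 * (norm (f x))\<^sup>2 + 2 * (norm (g x))\<^sup>2)"
      using assms by (simp add: L2_def)
    show "(\<lambda>x. (norm (f x + g x))\<^sup>2) \<in> borel_measurable (lebesgue_on \<Omega>)"
      using m by measurable
    show "AE x in lebesgue_on \<Omega>.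
        norm ((norm (f x + g x))\<^sup>2) \<le> norm (2 * (norm (f x))\<^sup>2 + 2 * (norm (g x))\<^sup>2)"
      by (auto simp: norm_add_square_le)
  qed
  with m show ?thesis by (simp add: L2_def)
qed

lemma L2_diff: "f \<in> L2 \<Omega> \<Longrightarrow> g \<in> L2 \<Omega> \<Longrightarrow> (\<lambda>x. f x - g x) \<in> L2 \<Omega>"
  using L2_add[of f \<Omega> "\<lambda>x. (- 1) *\<^sub>R g x"] L2_scaleR[of g \<Omega> "- 1"] by simp

lemma L2_zero: "(\<lambda>x. 0) \<in> L2 \<Omega>"
  by (simp add: L2_def)

lemma l2_inner_commute: "l2_inner \<Omega> f g = l2_inner \<Omega> g f"
  by (simp add: l2_inner_def inner_commute)

lemma l2_inner_add_left:
  "f \<in> L2 \<Omega> \<Longrightarrow> g \<in> L2 \<Omega> \<Longrightarrow> h \<in> L2 \<Omega> \<Longrightarrow>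
   l2_inner \<Omega> (\<lambda>x. f x + g x) h = l2_inner \<Omega> f h + l2_inner \<Omega> g h"
  by (simp add: l2_inner_def inner_add_left integrable_inner_L2)

lemma l2_inner_diff_left:
  "f \<in> L2 \<Omega> \<Longrightarrow> g \<in> L2 \<Omega> \<Longrightarrow> h \<in> L2 \<Omega> \<Longrightarrow>
   l2_inner \<Omega> (\<lambda>x. f x - g x) h = l2_inner \<Omega> f h - l2_inner \<Omega> g h"
  by (simp add: l2_inner_def inner_diff_left integrable_inner_L2)

lemma l2_inner_scaleR_left: "l2_inner \<Omega> (\<lambda>x. c *\<^sub>R f x) h = c * l2_inner \<Omega> f h"
  by (simp add: l2_inner_def)

lemma l2_inner_add_right:
  "f \<in> L2 \<Omega> \<Longrightarrow> g \<in> L2 \<Omega> \<Longrightarrow> h \<in> L2 \<Omega> \<Longrightarrow>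
   l2_inner \<Omega> h (\<lambda>x. f x + g x) = l2_inner \<Omega> h f + l2_inner \<Omega> h g"
  by (simp add: l2_inner_def inner_add_right integrable_inner_L2)

lemma l2_inner_diff_right:
  "f \<in> L2 \<Omega> \<Longrightarrow> g \<in> L2 \<Omega> \<Longrightarrow> h \<in> L2 \<Omega> \<Longrightarrow>
   l2_inner \<Omega> h (\<lambda>x. f x - g x) = l2_inner \<Omega> h f - l2_inner \<Omega> h g"
  by (simp add: l2_inner_def inner_diff_right integrable_inner_L2)

lemma l2_inner_scaleR_right: "l2_inner \<Omega> h (\<lambda>x. c *\<^sub>R f x) = c * l2_inner \<Omega> h f"
  by (simp add: l2_inner_def)

lemma l2_inner_cong:
  assumes "f \<in> L2 \<Omega>" "f' \<in> L2 \<Omega>" "g \<in> L2 \<Omega>" "g' \<in> L2 \<Omega>"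
    and "AE x in lebesgue_on \<Omega>. f x = f' x" "AE x in lebesgue_on \<Omega>. g x = g' x"
  shows "l2_inner \<Omega> f g = l2_inner \<Omega> f' g'"
  unfolding l2_inner_def
proof (rule integral_cong_AE)
  show "AE x in lebesgue_on \<Omega>. f x \<bullet> g x = f' x \<bullet> g' x"
    using assms(5,6) by eventually_elim simp
qed (use assms in \<open>auto intro!: borel_measurable_inner dest: L2_measurable\<close>)

lemma l2_inner_null: "AE x in lebesgue_on \<Omega>. f x = 0 \<Longrightarrow> l2_inner \<Omega> f g = 0"
  unfolding l2_inner_def by (rule integral_eq_zero_AE) auto

lemma l2_inner_self_nonneg: "0 \<le> l2_inner \<Omega> f f"
  by (simp add: l2_inner_def)

lemma l2_inner_self_eq_0_iff:
  assumes "f \<in> L2 \<Omega>"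
  shows "l2_inner \<Omega> f f = 0 \<longleftrightarrow> (AE x in lebesgue_on \<Omega>. f x = 0)"
  using integral_nonneg_eq_0_iff_AE[OF integrable_inner_L2[OF assms assms]]
  by (simp add: l2_inner_def)

lemma l2_norm_scaleR: "l2_norm \<Omega> (\<lambda>x. c *\<^sub>R f x) = \<bar>c\<bar> * l2_norm \<Omega> f"
  by (simp add: l2_norm_def l2_inner_scaleR_left l2_inner_scaleR_right real_sqrt_mult
      flip: mult.assoc power2_eq_square)

text \<open>The bound comes from integrating \<open>norm_add_square_le\<close>, which costs the factor \<open>2\<close>; a constant does no
harm in showing that sums of null sequences are null sequences.\<close>

lemma l2_norm_add_le:
  assumes "f \<in> L2 \<Omega>" "g \<in> L2 \<Omega>"
  shows "l2_norm \<Omega> (\<lambda>x. f x + g x) \<le> 2 * (l2_norm \<Omega> f + l2_norm \<Omega> g)"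
proof -
  have "l2_inner \<Omega> (\<lambda>x. f x + g x) (\<lambda>x. f x + g x)
      \<le> (LINT x|lebesgue_on \<Omega>. 2 * (f x \<bullet> f x) + 2 * (g x \<bullet> g x))"
    unfolding l2_inner_def
    by (rule integral_mono)
      (use norm_add_square_le[of "f _" "g _"] in
        \<open>auto simp: assms integrable_inner_L2 L2_add power2_norm_eq_inner\<close>)
  also have "\<dots> = 2 * l2_inner \<Omega> f f + 2 * l2_inner \<Omega> g g"
    by (simp add: l2_inner_def integrable_inner_L2 assms)
  also have "\<dots> \<le> (2 * (sqrt (l2_inner \<Omega> f f) + sqrt (l2_inner \<Omega> g g)))\<^sup>2"
    using l2_inner_self_nonneg[of \<Omega> f] l2_inner_self_nonneg[of \<Omega> g]
    by (simp add: power_mult_distrib power2_sum)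
  finally show ?thesis
    unfolding l2_norm_def using l2_inner_self_nonneg[of \<Omega> f] l2_inner_self_nonneg[of \<Omega> g]
    by (intro real_le_lsqrt) auto
qed

lemma l2_norm_cong:
  assumes "f \<in> L2 \<Omega>" "f' \<in> L2 \<Omega>" "AE x in lebesgue_on \<Omega>. f x = f' x"
  shows "l2_norm \<Omega> f = l2_norm \<Omega> f'"
  unfolding l2_norm_def using l2_inner_cong[OF assms(1,2) assms(1,2) assms(3,3)] by simp

section \<open>Representing functionals on finite-dimensional function spaces\<close>

text \<open>Elements of the function spaces are functions rather than classes modulo null sets, and function
types carry no vector space structure, so linear subspaces and linear functionals are described by
pointwise operations.\<close>

definition function_subspace :: "('a \<Rightarrow> 'b::real_vector) set \<Rightarrow> bool" where
  "function_subspace S \<longleftrightarrow> (\<lambda>x. 0) \<in> S \<and> (\<forall>f\<in>S. \<forall>g\<in>S. (\<lambda>x. f x + g x) \<in> S) \<and>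
     (\<forall>c. \<forall>f\<in>S. (\<lambda>x. c *\<^sub>R f x) \<in> S)"

definition linear_functional :: "('a \<Rightarrow> 'b::real_vector) set \<Rightarrow> (('a \<Rightarrow> 'b) \<Rightarrow> real) \<Rightarrow> bool" where
  "linear_functional S \<phi> \<longleftrightarrow> (\<forall>f\<in>S. \<forall>g\<in>S. \<phi> (\<lambda>x. f x + g x) = \<phi> f + \<phi> g) \<and>
     (\<forall>c. \<forall>f\<in>S. \<phi> (\<lambda>x. c *\<^sub>R f x) = c * \<phi> f)"

lemma function_subspaceD:
  assumes "function_subspace S"
  shows "(\<lambda>x. 0) \<in> S" "f \<in> S \<Longrightarrow> g \<in> S \<Longrightarrow> (\<lambda>x. f x + g x) \<in> S"
    "f \<in> S \<Longrightarrow> (\<lambda>x. c *\<^sub>R f x) \<in> S" "f \<in> S \<Longrightarrow> g \<in> S \<Longrightarrow> (\<lambda>x. f x - g x) \<in> S"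
proof -
  show 1: "f \<in> S \<Longrightarrow> g \<in> S \<Longrightarrow> (\<lambda>x. f x + g x) \<in> S" for f g
    using assms by (simp add: function_subspace_def)
  show 2: "f \<in> S \<Longrightarrow> (\<lambda>x. c *\<^sub>R f x) \<in> S" for f c
    using assms by (simp add: function_subspace_def)
  show "f \<in> S \<Longrightarrow> g \<in> S \<Longrightarrow> (\<lambda>x. f x - g x) \<in> S"
    using 1[of f "\<lambda>x. (- 1) *\<^sub>R g x"] 2[of g "- 1"] by simp
  show "(\<lambda>x. 0) \<in> S" using assms by (simp add: function_subspace_def)
qed

lemma linear_functionalD:
  assumes "linear_functional S \<phi>"
  shows "f \<in> S \<Longrightarrow> g \<in> S \<Longrightarrow> \<phi> (\<lambda>x. f x + g x) = \<phi> f + \<phi> g"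
    "f \<in> S \<Longrightarrow> \<phi> (\<lambda>x. c *\<^sub>R f x) = c * \<phi> f"
  using assms by (simp_all add: linear_functional_def)

lemma linear_functional_diff:
  assumes "linear_functional S \<phi>" "function_subspace S" "f \<in> S" "g \<in> S"
  shows "\<phi> (\<lambda>x. f x - g x) = \<phi> f - \<phi> g"
  using linear_functionalD(1)[OF assms(1,3), of "\<lambda>x. (- 1) *\<^sub>R g x"]
    linear_functionalD(2)[OF assms(1,4), of "- 1"] function_subspaceD(3)[OF assms(2,4), of "- 1"]
  by simp

lemma linear_functional_subset: "linear_functional S \<phi> \<Longrightarrow> T \<subseteq> S \<Longrightarrow> linear_functional T \<phi>"
  unfolding linear_functional_def by blast

lemma linear_functional_l2_inner:
  "S \<subseteq> L2 \<Omega> \<Longrightarrow> f \<in> L2 \<Omega> \<Longrightarrow> linear_functional S (l2_inner \<Omega> f)"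
  by (auto simp: linear_functional_def l2_inner_add_right l2_inner_scaleR_right subset_iff)

text \<open>A Riesz representation theorem in which \<^const>\<open>l2_inner\<close> is only semidefinite. Finite
dimensionality modulo null functions enters as finitely many linear functionals \<open>ev j\<close> whose common
zeros in \<open>S\<close> are null functions; in this form neither a basis nor quotients are involved. The
induction removes one functional at a time by passing to its kernel: \<open>S\<close> is spanned by that kernel
and one further function, which can be made orthogonal to the kernel by representing its inner
product there. The last premise makes \<open>\<phi>\<close> a functional on classes modulo null functions.\<close>

lemma riesz_representation_finitely_determined:
  fixes S :: "(real^'d \<Rightarrow> 'b::euclidean_space) set"
  assumes "finite J" "function_subspace S" "S \<subseteq> L2 \<Omega>"
    and "\<And>j. j \<in> J \<Longrightarrow> linear_functional S (ev j)"
    and "\<And>q. q \<in> S \<Longrightarrow> (\<And>j. j \<in> J \<Longrightarrow> ev j q = 0) \<Longrightarrow> AE x in lebesgue_on \<Omega>. q x = 0"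
    and "linear_functional S \<phi>"
    and "\<And>q. q \<in> S \<Longrightarrow> AE x in lebesgue_on \<Omega>. q x = 0 \<Longrightarrow> \<phi> q = 0"
  shows "\<exists>\<mu>\<in>S. \<forall>q\<in>S. l2_inner \<Omega> \<mu> q = \<phi> q"
  using assms
proof (induction J arbitrary: S \<phi> rule: finite_induct)
  case empty
  show ?case
  proof (intro bexI ballI)
    show "(\<lambda>x. 0) \<in> S" using empty.prems(1) by (rule function_subspaceD)
    fix q assume "q \<in> S"
    then have "\<phi> q = 0" using empty.prems by auto
    then show "l2_inner \<Omega> (\<lambda>x. 0) q = \<phi> q" by (simp add: l2_inner_null)
  qed
next
  case (insert k J)
  note S = function_subspaceD[OF insert.prems(1)]
  define S0 where "S0 = {q \<in> S. ev k q = 0}"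
  note evk = linear_functionalD[OF insert.prems(3)[OF insertI1]]
  have S0S: "S0 \<subseteq> S" by (auto simp: S0_def)
  have sub: "function_subspace S0"
    using S evk evk(2)[OF S(1), of 0] by (auto simp: function_subspace_def S0_def)
  have L2S: "q \<in> S \<Longrightarrow> q \<in> L2 \<Omega>" for q using insert.prems(2) by auto
  have IH: "\<exists>\<mu>\<in>S0. \<forall>q\<in>S0. l2_inner \<Omega> \<mu> q = \<eta> q"
    if lin: "linear_functional S \<eta>"
      and van: "\<And>q. q \<in> S \<Longrightarrow> AE x in lebesgue_on \<Omega>. q x = 0 \<Longrightarrow> \<eta> q = 0" for \<eta>
  proof (rule insert.IH[OF sub])
    show "S0 \<subseteq> L2 \<Omega>" using S0S insert.prems(2) by blast
    show "linear_functional S0 (ev j)" if "j \<in> J" for j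
      using insert.prems(3)[of j] that linear_functional_subset[OF _ S0S] by blast
    show "AE x in lebesgue_on \<Omega>. q x = 0" if "q \<in> S0" "\<And>j. j \<in> J \<Longrightarrow> ev j q = 0" for q
      by (rule insert.prems(4)) (use that in \<open>auto simp: S0_def\<close>)
    show "linear_functional S0 \<eta>" by (rule linear_functional_subset[OF lin S0S])
    show "\<eta> q = 0" if "q \<in> S0" "AE x in lebesgue_on \<Omega>. q x = 0" for q
      using van that S0S by blast
  qed
  obtain \<mu>0 where \<mu>0: "\<mu>0 \<in> S0" "\<forall>q\<in>S0. l2_inner \<Omega> \<mu>0 q = \<phi> q"
    using IH[OF insert.prems(5,6)] by blast
  show ?case
  proof (cases "S0 = S")
    case True
    with \<mu>0 show ?thesis by blast
  next
    case False
    then obtain b where b: "b \<in> S" "ev k b \<noteq> 0" by (auto simp: S0_def)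
    obtain b0 where b0: "b0 \<in> S0" "\<forall>q\<in>S0. l2_inner \<Omega> b0 q = l2_inner \<Omega> b q"
      using IH[OF linear_functional_l2_inner[OF insert.prems(2) L2S[OF b(1)]]]
      by (metis l2_inner_commute l2_inner_null)
    have inS: "b0 \<in> S" "\<mu>0 \<in> S" using b0(1) \<mu>0(1) S0S by auto
    \<comment> \<open>the part of \<open>b\<close> orthogonal to \<open>S0\<close>; as \<open>ev k\<close> does not vanish on it, it spans \<open>S\<close> together with \<open>S0\<close>\<close>
    define e where "e = (\<lambda>x. b x - b0 x)"
    have eS: "e \<in> S" unfolding e_def by (rule S(4)[OF b(1) inS(1)])
    have eve: "ev k e \<noteq> 0"
      using linear_functional_diff[OF insert.prems(3)[OF insertI1] insert.prems(1) b(1) inS(1)] b b0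
      by (simp add: e_def S0_def)
    have orth: "l2_inner \<Omega> s e = 0" if "s \<in> S0" for s
    proof -
      have "s \<in> S" using that S0S by auto
      then show ?thesis
        unfolding e_def using b0(2) that
        by (simp add: l2_inner_commute[of \<Omega> s] l2_inner_diff_left L2S b(1) inS)
    qed
    define t where "t = \<phi> e / l2_inner \<Omega> e e"
    define \<mu> where "\<mu> = (\<lambda>x. \<mu>0 x + t *\<^sub>R e x)"
    have t: "t * l2_inner \<Omega> e e = \<phi> e"
    proof (cases "l2_inner \<Omega> e e = 0")
      case True
      then have "\<phi> e = 0"
        using insert.prems(6)[OF eS] l2_inner_self_eq_0_iff[OF L2S[OF eS]] by simp
      with True show ?thesis by simp
    qed (simp add: t_def)
    have \<mu>S: "\<mu> \<in> S" unfolding \<mu>_def by (intro S(2) S(3) inS eS)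
    have "l2_inner \<Omega> \<mu> q = \<phi> q" if "q \<in> S" for q
    proof -
      define c where "c = ev k q / ev k e"
      define s where "s = (\<lambda>x. q x - c *\<^sub>R e x)"
      have sS: "s \<in> S" unfolding s_def by (intro S(3,4) eS that)
      have "ev k s = ev k q - c * ev k e"
        unfolding s_def
        using linear_functional_diff[OF insert.prems(3)[OF insertI1] insert.prems(1) that S(3)[OF eS, of c]]
          evk(2)[OF eS] by simp
      then have sS0: "s \<in> S0" using eve sS by (simp add: S0_def c_def)
      have q: "q = (\<lambda>x. s x + c *\<^sub>R e x)" by (simp add: s_def)
      have "l2_inner \<Omega> \<mu> s = \<phi> s"
        using \<mu>0(2) sS0 orth[OF sS0] unfolding \<mu>_def
        by (simp add: l2_inner_add_left l2_inner_scaleR_left L2S L2_scaleR inS eS sS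
            l2_inner_commute[of \<Omega> e])
      moreover have "l2_inner \<Omega> \<mu> e = \<phi> e"
        using orth[OF \<mu>0(1)] t unfolding \<mu>_def
        by (simp add: l2_inner_add_left l2_inner_scaleR_left L2S L2_scaleR inS eS)
      ultimately have "l2_inner \<Omega> \<mu> (\<lambda>x. s x + c *\<^sub>R e x) = \<phi> s + c * \<phi> e"
        by (simp add: l2_inner_add_right l2_inner_scaleR_right L2S L2_scaleR \<mu>S eS sS)
      also have "\<dots> = \<phi> (\<lambda>x. s x + c *\<^sub>R e x)"
        using linear_functionalD[OF insert.prems(5)] sS S(3)[OF eS] eS by simp
      finally show ?thesis using q by simp
    qed
    with \<mu>S show ?thesis by blast
  qed
qed

section \<open>Smooth functions\<close>

lemma continuously_differentiable_SucI:
  assumes "\<And>x. (f has_derivative f' x) (at x)"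
    and "\<And>j. continuously_differentiable k (\<lambda>x. f' x (axis j 1))"
  shows "continuously_differentiable (Suc k) f"
  using assms frechet_derivative_at[OF assms(1)] by (auto intro: differentiableI)

lemma continuously_differentiable_SucD:
  assumes "continuously_differentiable (Suc k) f"
  shows "(f has_derivative frechet_derivative f (at x)) (at x)"
    "continuously_differentiable k (\<lambda>x. frechet_derivative f (at x) (axis j 1))"
  using assms by (auto simp: frechet_derivative_works)

lemma continuously_differentiable_add:
  "continuously_differentiable k f \<Longrightarrow> continuously_differentiable k g \<Longrightarrow>
   continuously_differentiable k (\<lambda>x. f x + g x)"
proof (induction k arbitrary: f g)
  case (Suc k)
  note f = continuously_differentiable_SucD[OF Suc.prems(1)]
    and g = continuously_differentiable_SucD[OF Suc.prems(2)]
  show ?case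
    by (rule continuously_differentiable_SucI[OF has_derivative_add[OF f(1) g(1)]])
      (rule Suc.IH[OF f(2) g(2)])
qed (simp add: continuous_on_add)

lemma continuously_differentiable_scaleR:
  "continuously_differentiable k f \<Longrightarrow> continuously_differentiable k (\<lambda>x. c *\<^sub>R f x)"
proof (induction k arbitrary: f)
  case (Suc k)
  note f = continuously_differentiable_SucD[OF Suc.prems]
  show ?case
    by (rule continuously_differentiable_SucI[OF has_derivative_scaleR_right[OF f(1)]])
      (rule Suc.IH[OF f(2)])
qed (simp add: continuous_on_scaleR)

lemma continuously_differentiable_imp_continuous:
  "continuously_differentiable k f \<Longrightarrow> continuous_on UNIV f"
proof (cases k)
  case (Suc m)
  assume "continuously_differentiable k f"
  with Suc have "f differentiable_on UNIV" by (simp add: differentiable_on_def)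
  then show "continuous_on UNIV f" by (rule differentiable_imp_continuous_on)
qed simp

text \<open>Needed for the product rule, where a factor reappears underived and must be one degree less
differentiable.\<close>

lemma continuously_differentiable_lower:
  "continuously_differentiable (Suc k) f \<Longrightarrow> continuously_differentiable k f"
proof (induction k arbitrary: f)
  case 0
  show ?case
    using continuously_differentiable_imp_continuous[OF 0] by simp
next
  case (Suc k)
  note f = continuously_differentiable_SucD[OF Suc.prems]
  show ?case
    by (rule continuously_differentiable_SucI[OF f(1)]) (rule Suc.IH[OF f(2)])
qed

lemma continuously_differentiable_mult:
  fixes f g :: "real^'d \<Rightarrow> real"
  shows "continuously_differentiable k f \<Longrightarrow> continuously_differentiable k g \<Longrightarrow>
    continuously_differentiable k (\<lambda>x. f x * g x)"
proof (induction k arbitrary: f g)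
  case (Suc k)
  note f = continuously_differentiable_SucD[OF Suc.prems(1)]
    and g = continuously_differentiable_SucD[OF Suc.prems(2)]
  show ?case
    by (rule continuously_differentiable_SucI[OF has_derivative_mult[OF f(1) g(1)]])
      (intro continuously_differentiable_add Suc.IH f(2) g(2)
        continuously_differentiable_lower[OF Suc.prems(1)]
        continuously_differentiable_lower[OF Suc.prems(2)])
qed (simp add: continuous_on_mult)

lemma continuously_differentiable_const: "continuously_differentiable k (\<lambda>x. c)"
proof (induction k arbitrary: c)
  case (Suc k)
  show ?case by (rule continuously_differentiable_SucI[OF has_derivative_const]) (rule Suc.IH)
qed simp

lemma continuously_differentiable_prod:
  fixes f :: "'i \<Rightarrow> real^'d \<Rightarrow> real"
  assumes "finite I" "\<And>i. i \<in> I \<Longrightarrow> continuously_differentiable k (f i)"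
  shows "continuously_differentiable k (\<lambda>x. \<Prod>i\<in>I. f i x)"
  using assms
  by (induction I rule: finite_induct)
    (auto intro: continuously_differentiable_mult continuously_differentiable_const)

text \<open>A sequence \<open>D\<close> in which every function is the derivative of its predecessor is a smooth function of
one variable together with all its derivatives; in this form the chain rule is an induction that
only moves along the sequence.\<close>

lemma continuously_differentiable_affine_coordinate:
  fixes D :: "nat \<Rightarrow> real \<Rightarrow> real"
  assumes D: "\<And>m y. (D m has_real_derivative D (Suc m) y) (at y)"
  shows "continuously_differentiable k (\<lambda>x :: real^'d. D m (c * x $ i + t))"
proof (induction k arbitrary: m)
  case 0
  have "continuous_on UNIV (D m)" for m
    by (meson D DERIV_continuous_on has_field_derivative_at_within)
  then have "continuous_on UNIV (\<lambda>x :: real^'d. D m (c * x $ i + t))"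
    by (rule continuous_on_compose2) (auto intro!: continuous_intros)
  then show ?case by simp
next
  case (Suc k)
  have "((\<lambda>x :: real^'d. c * x $ i + t) has_derivative (\<lambda>h. c * h $ i)) (at x)" for x
    by (auto intro!: derivative_eq_intros bounded_linear.has_derivative[OF bounded_linear_vec_nth])
  from has_derivative_compose[OF this D[of m, THEN has_field_derivative_imp_has_derivative]]
  have "((\<lambda>x :: real^'d. D m (c * x $ i + t)) has_derivative
      (\<lambda>h. D (Suc m) (c * x $ i + t) * (c * h $ i))) (at x)" for x
    by (simp add: mult.commute)
  then show ?case
  proof (rule continuously_differentiable_SucI)
    show "continuously_differentiable k
        (\<lambda>x. D (Suc m) (c * x $ i + t) * (c * axis j (1::real) $ i))" for j
      using continuously_differentiable_scaleR[OF Suc.IH[of "Suc m"], of "c * axis j 1 $ i"]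
      by (simp add: mult.commute)
  qed
qed

section \<open>Bump functions\<close>

text \<open>The \<open>k\<close>-th derivative of \<open>exp (- (1 / x))\<close> on \<open>x > 0\<close> is \<open>exp (- (1 / x))\<close> times the value of
\<open>flat_poly k\<close> at \<open>1 / x\<close>; \<open>flat k\<close> extends it by \<open>0\<close>.\<close>

primrec flat_poly :: "nat \<Rightarrow> real poly" where
  "flat_poly 0 = 1"
| "flat_poly (Suc k) = [:0, 0, 1:] * (flat_poly k - pderiv (flat_poly k))"

definition flat :: "nat \<Rightarrow> real \<Rightarrow> real" where
  "flat k x = (if x \<le> 0 then 0 else poly (flat_poly k) (1 / x) * exp (- (1 / x)))"

lemma poly_times_exp_minus_tendsto_0:
  fixes P :: "real poly"
  shows "((\<lambda>z. poly P z * exp (- z)) \<longlongrightarrow> 0) at_top"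
proof -
  have "((\<lambda>z. \<Sum>i\<le>degree P. coeff P i * (z ^ i / exp z)) \<longlongrightarrow> (\<Sum>i\<le>degree P. coeff P i * 0)) at_top"
    by (intro tendsto_sum tendsto_mult tendsto_const tendsto_power_div_exp_0)
  then show ?thesis
    by (simp add: poly_altdef sum_distrib_right exp_minus divide_inverse mult.assoc)
qed

text \<open>Away from \<open>0\<close> this is the recursion for \<^const>\<open>flat_poly\<close>. At \<open>0\<close> the right difference quotient is a
polynomial in \<open>1 / x\<close> times \<open>exp (- (1 / x))\<close>, and the exponential wins.\<close>

lemma flat_has_derivative: "(flat k has_real_derivative flat (Suc k) x) (at x)"
proof -
  consider "x < 0" | "x = 0" | "x > 0" by linarith
  then show ?thesis
  proof cases
    case 1
    have "((\<lambda>x. 0) has_real_derivative flat (Suc k) x) (at x)"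
      using 1 by (simp add: flat_def)
    then show ?thesis
      by (rule has_field_derivative_transform_within_open[where S = "{..<0}"])
        (use 1 in \<open>auto simp: flat_def\<close>)
  next
    case 2
    have "((\<lambda>z. poly ([:0, 1:] * flat_poly k) (inverse z) * exp (- (inverse z))) \<longlongrightarrow> 0) (at_right 0)"
      by (rule filterlim_compose[OF poly_times_exp_minus_tendsto_0 filterlim_inverse_at_top_right])
    then have "((\<lambda>z. flat k z / z) \<longlongrightarrow> 0) (at_right 0)"
    proof (rule Lim_transform_eventually)
      show "\<forall>\<^sub>F z in at_right 0.
          poly ([:0, 1:] * flat_poly k) (inverse z) * exp (- inverse z) = flat k z / z"
        by (auto simp: eventually_at_filter flat_def divide_simps)
    qed
    moreover have "((\<lambda>z. flat k z / z) \<longlongrightarrow> 0) (at_left 0)"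
      by (rule Lim_transform_eventually[OF tendsto_const])
        (auto simp: eventually_at_filter flat_def)
    ultimately have "((\<lambda>z. flat k z / z) \<longlongrightarrow> 0) (at 0)"
      by (rule filterlim_split_at[rotated])
    then show ?thesis
      using 2 by (simp add: has_field_derivative_iff flat_def)
  next
    case 3
    have "((\<lambda>x. poly (flat_poly k) (1 / x) * exp (- (1 / x))) has_real_derivative flat (Suc k) x) (at x)"
      using 3
      by (auto intro!: derivative_eq_intros simp: flat_def field_simps power2_eq_square)
    then show ?thesis
      by (rule has_field_derivative_transform_within_open[where S = "{0<..}"])
        (use 3 in \<open>auto simp: flat_def\<close>)
  qed
qed

text \<open>With increasing \<open>n\<close> each factor \<open>flat 0 (n * y)\<close> increases to \<open>1\<close> for \<open>y > 0\<close>, so that these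
functions approximate the indicator of the box. The arguments are written as affine functions of
a coordinate in order to match \<open>continuously_differentiable_affine_coordinate\<close>.\<close>

definition box_bump :: "real^'d \<Rightarrow> real^'d \<Rightarrow> nat \<Rightarrow> real^'d \<Rightarrow> real" where
  "box_bump a b n x =
     (\<Prod>i\<in>UNIV. flat 0 (real n * x $ i + - real n * a $ i) * flat 0 (- real n * x $ i + real n * b $ i))"

lemma smooth_box_bump: "smooth (box_bump a b n)"
  unfolding smooth_def box_bump_def
  by (intro allI continuously_differentiable_prod continuously_differentiable_mult
      continuously_differentiable_affine_coordinate flat_has_derivative finite)

lemma flat_0_bounds: "0 \<le> flat 0 x" "flat 0 x \<le> 1"
  by (simp_all add: flat_def)

lemma box_bump_bounds: "0 \<le> box_bump a b n x" "box_bump a b n x \<le> 1"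
  unfolding box_bump_def
  by (auto intro!: prod_nonneg prod_le_1 mult_nonneg_nonneg mult_le_one flat_0_bounds)

lemma box_bump_outside:
  assumes "x \<notin> box a b"
  shows "box_bump a b n x = 0"
proof -
  obtain i where "x $ i \<le> a $ i \<or> b $ i \<le> x $ i"
    using assms by (auto simp: mem_box_cart not_less)
  then have "real n * x $ i \<le> real n * a $ i \<or> real n * b $ i \<le> real n * x $ i"
    by (auto intro: mult_left_mono)
  then have "flat 0 (real n * x $ i + - real n * a $ i) * flat 0 (- real n * x $ i + real n * b $ i) = 0"
    by (auto simp: flat_def)
  then show ?thesis unfolding box_bump_def by (intro prod_zero) auto
qed

lemma flat_0_tendsto_1:
  assumes "y > 0"
  shows "(\<lambda>n. flat 0 (real n * y)) \<longlonglongrightarrow> 1"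
proof -
  have "(\<lambda>n. exp (- (1 / (real n * y)))) \<longlonglongrightarrow> exp (- 0)"
    by (intro tendsto_exp tendsto_minus tendsto_divide_0[OF tendsto_const]
        filterlim_at_top_imp_at_infinity filterlim_at_top_mult_tendsto_pos[OF tendsto_const assms]
        filterlim_real_sequentially)
  then have "(\<lambda>n. exp (- (1 / (real n * y)))) \<longlonglongrightarrow> 1" by simp
  then show ?thesis
  proof (rule Lim_transform_eventually)
    show "\<forall>\<^sub>F n in sequentially. exp (- (1 / (real n * y))) = flat 0 (real n * y)"
      using eventually_gt_at_top[of 0]
      by eventually_elim (use assms in \<open>auto simp: flat_def mult_le_0_iff\<close>)
  qed
qed

lemma box_bump_tendsto: "(\<lambda>n. box_bump a b n x) \<longlonglongrightarrow> indicator (box a b) x"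
proof (cases "x \<in> box a b")
  case True
  have "(\<lambda>n. \<Prod>i\<in>UNIV. flat 0 (real n * (x $ i - a $ i)) * flat 0 (real n * (b $ i - x $ i)))
      \<longlonglongrightarrow> (\<Prod>i\<in>(UNIV::'a set). 1 * 1)"
    by (intro tendsto_prod tendsto_mult flat_0_tendsto_1) (use True in \<open>auto simp: mem_box_cart\<close>)
  moreover have "box_bump a b n x =
      (\<Prod>i\<in>UNIV. flat 0 (real n * (x $ i - a $ i)) * flat 0 (real n * (b $ i - x $ i)))" for n
    unfolding box_bump_def by (simp add: algebra_simps)
  ultimately show ?thesis using True by simp
qed (simp add: box_bump_outside)

lemma test_function_box_bump:
  assumes "cbox a b \<subseteq> \<Omega>"
  shows "test_function \<Omega> (box_bump a b n)"
  unfolding test_function_def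
proof (intro conjI exI[of _ "cbox a b"] allI impI)
  show "box_bump a b n x = 0" if "x \<notin> cbox a b" for x
    using that box_subset_cbox[of a b] by (intro box_bump_outside) blast
qed (use assms smooth_box_bump in auto)

section \<open>Uniqueness of weak gradients\<close>

text \<open>Open boxes form an intersection-stable generator of the Borel sets, and the sets over which the
integral of \<open>h\<close> vanishes form a Dynkin system. Hence the integral vanishes over every Lebesgue set,
in particular over those where \<open>h\<close> is positive or negative.\<close>

lemma AE_0_if_box_integrals_0:
  fixes h :: "'a::euclidean_space \<Rightarrow> real"
  assumes int: "integrable lebesgue h" and UNIV0: "integral\<^sup>L lebesgue h = 0"
    and box0: "\<And>a b. (LINT x:box a b|lebesgue. h x) = 0"
  shows "AE x in lebesgue. h x = 0"
proof (rule density_unique_real[OF int])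
  show "integrable lebesgue (\<lambda>x :: 'a. 0 :: real)" by simp
  have setint: "set_integrable lebesgue A h" if "A \<in> sets lebesgue" for A
    unfolding set_integrable_def by (rule integrable_mult_indicator[OF that int])
  have borel0: "(LINT x:A|lebesgue. h x) = 0" if "A \<in> sets borel" for A
  proof -
    have "Int_stable (range (\<lambda>(a, b). box a b :: 'a set))"
      by (auto simp: Int_stable_def box_Int_box)
    moreover have "range (\<lambda>(a, b). box a b :: 'a set) \<subseteq> Pow UNIV" by auto
    moreover have "A \<in> sigma_sets UNIV (range (\<lambda>(a, b). box a b))"
      using that unfolding borel_eq_box by simp
    ultimately show ?thesis
    proof (induction rule: sigma_sets_induct_disjoint)
      case (basic A)
      then show ?case using box0 by auto
    next
      case empty
      show ?case by (simp add: set_lebesgue_integral_def)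
    next
      case (compl A)
      then have A: "A \<in> sets lebesgue" by (simp add: borel_eq_box)
      have "(LINT x:A \<union> (UNIV - A)|lebesgue. h x) = (LINT x:A|lebesgue. h x) + (LINT x:UNIV - A|lebesgue. h x)"
        by (rule set_integral_Un) (use setint[OF A] setint[OF sets.compl_sets[OF A]] in auto)
      then show ?case using compl UNIV0 by (simp add: set_lebesgue_integral_def)
    next
      case (union F)
      then have F: "\<And>i. F i \<in> sets lebesgue"
        by (simp add: borel_eq_box subset_eq)
      have "(LINT x:(\<Union>i. F i)|lebesgue. h x) = (\<Sum>i. LINT x:F i|lebesgue. h x)"
        by (rule lebesgue_integral_countable_add)
          (use F union(1) setint in \<open>auto simp: disjoint_family_on_def\<close>)
      with union(3) show ?case by simp
    qed
  qed
  fix A :: "'a set" assume A: "A \<in> sets lebesgue"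
  then obtain B N where BN: "B \<in> sets borel" "negligible N" "B \<union> N = A"
    by (rule sets_lebesgue_almost_borel)
  have "(LINT x:A|lebesgue. h x) = (LINT x:B|lebesgue. h x)"
  proof (rule set_integral_null_delta)
    have "A - B \<union> (B - A) \<subseteq> N" using BN(3) by auto
    then have "negligible (A - B \<union> (B - A))" using BN(2) negligible_subset by blast
    then show "A - B \<union> (B - A) \<in> null_sets lebesgue" by (simp add: negligible_iff_null_sets)
  qed (use A BN int in auto)
  with borel0[OF BN(1)] show "(LINT x:A|lebesgue. h x) = (LINT x:A|lebesgue. 0)"
    by (simp add: set_lebesgue_integral_def)
qed

text \<open>Testing with bump functions of a box and dominated convergence show that \<open>g\<close> has integral \<open>0\<close> over
every open box whose closure lies in \<open>\<Omega>\<close>. This gives \<open>g = 0\<close> almost everywhere in each such box, and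
countably many of them cover \<open>\<Omega>\<close>.\<close>

lemma fundamental_lemma_of_variations:
  fixes g :: "real^'d \<Rightarrow> real"
  assumes "open \<Omega>" and g: "integrable (lebesgue_on \<Omega>) g"
    and orth: "\<And>\<phi>. test_function \<Omega> \<phi> \<Longrightarrow> (LINT x|lebesgue_on \<Omega>. g x * \<phi> x) = 0"
  shows "AE x in lebesgue_on \<Omega>. g x = 0"
proof -
  have \<Omega>: "\<Omega> \<in> sets lebesgue" using assms(1) by auto
  then have restr: "(LINT x|lebesgue_on \<Omega>. u x) = (LINT x|lebesgue. indicator \<Omega> x * u x)" for u :: "_ \<Rightarrow> real"
    by (simp add: integral_restrict_space)
  have gm: "g \<in> borel_measurable (lebesgue_on \<Omega>)" using g by auto
  have box_int: "(LINT x|lebesgue_on \<Omega>. g x * indicator (box a b) x) = 0" if ab: "cbox a b \<subseteq> \<Omega>" for a b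
  proof -
    have "(\<lambda>n. LINT x|lebesgue_on \<Omega>. g x * box_bump a b n x)
        \<longlonglongrightarrow> (LINT x|lebesgue_on \<Omega>. g x * indicator (box a b) x)"
    proof (rule integral_dominated_convergence[where w = "\<lambda>x. norm (g x)"])
      have "(\<lambda>x. box_bump a b n x) \<in> borel_measurable (lebesgue_on \<Omega>)" for n
        using smooth_box_bump[of a b n] continuously_differentiable.simps(1)
        unfolding smooth_def
        by (metis \<Omega> continuous_imp_measurable_on_sets_lebesgue continuous_on_subset subset_UNIV)
      then show "(\<lambda>x. g x * box_bump a b n x) \<in> borel_measurable (lebesgue_on \<Omega>)" for n
        using gm by (intro borel_measurable_times)
      show "(\<lambda>x. g x * indicator (box a b) x) \<in> borel_measurable (lebesgue_on \<Omega>)"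
        using gm by (intro borel_measurable_times borel_measurable_indicator)
          (use ab box_subset_cbox[of a b] in
            \<open>auto simp: sets_restrict_space intro!: image_eqI[where x = "box a b"] \<Omega>\<close>)
      show "AE x in lebesgue_on \<Omega>. (\<lambda>n. g x * box_bump a b n x) \<longlonglongrightarrow> g x * indicator (box a b) x"
        by (intro AE_I2 tendsto_mult tendsto_const box_bump_tendsto)
      show "AE x in lebesgue_on \<Omega>. norm (g x * box_bump a b n x) \<le> norm (g x)" for n
        using box_bump_bounds[of a b n] by (auto simp: abs_mult intro!: AE_I2 mult_left_le)
    qed (use g in auto)
    moreover have "(\<lambda>n. LINT x|lebesgue_on \<Omega>. g x * box_bump a b n x) = (\<lambda>n. 0)"
      using orth[OF test_function_box_bump[OF ab]] by simp
    ultimately show ?thesis by (simp add: LIMSEQ_const_iff)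
  qed
  have local: "AE x in lebesgue. x \<in> box a b \<longrightarrow> g x = 0" if ab: "cbox a b \<subseteq> \<Omega>" for a b
  proof -
    \<comment> \<open>all boxes, not only those inside \<open>\<Omega>\<close>, have to be tested, so \<open>g\<close> is cut off to the given box\<close>
    define h where "h = (\<lambda>x. indicator \<Omega> x * (g x * indicator (box a b) x))"
    have h0: "integral\<^sup>L lebesgue h = 0"
      using box_int[OF ab] by (simp add: h_def restr)
    have inth: "integrable lebesgue h"
    proof -
      have "integrable lebesgue (\<lambda>x. indicator \<Omega> x *\<^sub>R g x)"
        using g \<Omega> by (subst (asm) integrable_restrict_space) auto
      from integrable_mult_indicator[OF _ this, of "box a b"]
      show ?thesis by (simp add: h_def mult_ac)
    qed
    have "AE x in lebesgue. h x = 0"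
    proof (rule AE_0_if_box_integrals_0[OF inth h0])
      fix c d :: "real^'d"
      obtain a' b' where eq: "box c d \<inter> box a b = box a' b'" and sub: "cbox a' b' \<subseteq> cbox a b"
      proof
        show "box c d \<inter> box a b = box (\<chi> i. max (c $ i) (a $ i)) (\<chi> i. min (d $ i) (b $ i))"
          by (auto simp: set_eq_iff mem_box_cart)
        show "cbox (\<chi> i. max (c $ i) (a $ i)) (\<chi> i. min (d $ i) (b $ i)) \<subseteq> cbox a b"
          by (auto simp: mem_box_cart)
      qed
      have "(LINT x:box c d|lebesgue. h x)
          = (LINT x|lebesgue. indicator \<Omega> x * (g x * indicator (box c d \<inter> box a b) x))"
        unfolding set_lebesgue_integral_def h_def
        by (rule Bochner_Integration.integral_cong) (auto simp: indicator_def)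
      also have "\<dots> = 0"
        using box_int[of a' b'] sub ab unfolding eq restr by auto
      finally show "(LINT x:box c d|lebesgue. h x) = 0" .
    qed
    then show ?thesis
      by (rule AE_mp) (use ab box_subset_cbox[of a b] in \<open>auto simp: h_def intro!: AE_I2\<close>)
  qed
  obtain \<D> where D: "countable \<D>" "\<D> \<subseteq> Pow \<Omega>" "\<And>X. X \<in> \<D> \<Longrightarrow> \<exists>a b. X = cbox a b" "\<Union>\<D> = \<Omega>"
    by (rule open_countable_Union_open_cbox[OF assms(1)]) blast
  have cbox_null: "AE x in lebesgue. x \<in> X \<longrightarrow> g x = 0" if "X \<in> \<D>" for X
  proof -
    obtain a b where X: "X = cbox a b" using D(3) \<open>X \<in> \<D>\<close> by blast
    have "negligible (cbox a b - box a b)"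
      by (rule negligible_frontier_interval)
    then have "AE x in lebesgue. x \<notin> cbox a b - box a b"
      by (intro AE_not_in) (simp add: negligible_iff_null_sets)
    moreover have "AE x in lebesgue. x \<in> box a b \<longrightarrow> g x = 0"
      by (rule local) (use D(2) that X in auto)
    ultimately show ?thesis unfolding X by eventually_elim auto
  qed
  have "AE x in lebesgue. \<forall>X\<in>\<D>. x \<in> X \<longrightarrow> g x = 0"
    unfolding AE_ball_countable[OF D(1)] using cbox_null by blast
  then have "AE x in lebesgue. x \<in> \<Omega> \<longrightarrow> g x = 0"
    by (rule AE_mp) (use D(4) in \<open>auto intro!: AE_I2\<close>)
  then show ?thesis using \<Omega> by (simp add: AE_restrict_space_iff)
qed

section \<open>Weak gradients and strains\<close>

lemma L2_bounded_linear:
  assumes f: "f \<in> L2 \<Omega>" and h: "bounded_linear h"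
  shows "(\<lambda>x. h (f x)) \<in> L2 \<Omega>"
proof -
  obtain B where "\<And>y. norm (h y) \<le> norm y * B"
    using bounded_linear.bounded[OF h] by blast
  then have "AE x in lebesgue_on \<Omega>. norm (h (f x)) \<le> B * norm (f x)"
    by (simp add: mult.commute)
  moreover have "continuous_on UNIV h"
    by (rule linear_continuous_on[OF h])
  then have "(\<lambda>x. h (f x)) \<in> borel_measurable (lebesgue_on \<Omega>)"
    by (rule measurable_compose[OF L2_measurable[OF f] borel_measurable_continuous_onI])
  ultimately show ?thesis using L2I_dominated[OF _ f] by blast
qed

lemma L2_vec_nth:
  fixes f :: "real^'d \<Rightarrow> 'b::euclidean_space^'n"
  shows "f \<in> L2 \<Omega> \<Longrightarrow> (\<lambda>x. f x $ i) \<in> L2 \<Omega>"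
  by (rule L2_bounded_linear[OF _ bounded_linear_vec_nth])

lemma is_weak_grad_iff_l2_inner:
  "is_weak_grad \<Omega> v G \<longleftrightarrow> (\<forall>\<phi> i j. test_function \<Omega> \<phi> \<longrightarrow>
     l2_inner \<Omega> (\<lambda>x. v x $ i) (\<lambda>x. frechet_derivative \<phi> (at x) (axis j 1))
     = - l2_inner \<Omega> (\<lambda>x. G x $ i $ j) \<phi>)"
  by (simp add: is_weak_grad_def l2_inner_def)

lemma smooth_add: "smooth f \<Longrightarrow> smooth g \<Longrightarrow> smooth (\<lambda>x. f x + g x)"
  by (simp add: smooth_def continuously_differentiable_add)

lemma smooth_scaleR: "smooth f \<Longrightarrow> smooth (\<lambda>x. c *\<^sub>R f x)"
  by (simp add: smooth_def continuously_differentiable_scaleR)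

lemma smooth_continuous: "smooth f \<Longrightarrow> continuous_on UNIV f"
  unfolding smooth_def using continuously_differentiable_imp_continuous by blast

lemma smooth_has_derivative:
  "smooth f \<Longrightarrow> (f has_derivative frechet_derivative f (at x)) (at x)"
  unfolding smooth_def using continuously_differentiable_SucD(1) by blast

lemma smooth_continuous_partial:
  "smooth f \<Longrightarrow> continuous_on UNIV (\<lambda>x. frechet_derivative f (at x) (axis j 1))"
  unfolding smooth_def
  using continuously_differentiable_SucD(2)[of 0 f j] by (simp del: continuously_differentiable.simps(2))

lemma jacobian_entry: "jacobian f (at x) $ i $ j = frechet_derivative f (at x) (axis j 1) $ i"
  by (simp add: jacobian_def matrix_def)

lemma jacobian_add:
  assumes "smooth f" "smooth g"
  shows "jacobian (\<lambda>x. f x + g x) (at x) = jacobian f (at x) + jacobian g (at x)"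
  using frechet_derivative_at[OF has_derivative_add[OF smooth_has_derivative[OF assms(1)]
      smooth_has_derivative[OF assms(2)]], of x]
  by (auto simp: vec_eq_iff jacobian_entry fun_eq_iff)

lemma jacobian_scaleR:
  assumes "smooth f"
  shows "jacobian (\<lambda>x. c *\<^sub>R f x) (at x) = c *\<^sub>R jacobian f (at x)"
  using frechet_derivative_at[OF has_derivative_scaleR_right[OF smooth_has_derivative[OF assms]], of c x]
  by (auto simp: vec_eq_iff jacobian_entry fun_eq_iff)

lemma continuous_jacobian:
  fixes f :: "real^'d \<Rightarrow> real^'e"
  shows "smooth f \<Longrightarrow> continuous_on UNIV (\<lambda>x. jacobian f (at x))"
  unfolding jacobian_def matrix_def
  by (intro continuous_on_vec_lambda continuous_on_component smooth_continuous_partial)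

lemma test_function_smooth: "test_function \<Omega> \<phi> \<Longrightarrow> smooth \<phi>"
  by (simp add: test_function_def)

lemma continuous_L2:
  fixes f :: "real^'d \<Rightarrow> 'b::euclidean_space"
  assumes "open \<Omega>" "bounded \<Omega>" "continuous_on UNIV f"
  shows "f \<in> L2 \<Omega>"
proof -
  have "compact (f ` closure \<Omega>)"
    using assms by (intro compact_continuous_image) (auto intro: continuous_on_subset)
  then obtain B where B: "\<And>x. x \<in> closure \<Omega> \<Longrightarrow> norm (f x) \<le> B"
    by (meson bounded_iff compact_imp_bounded imageI)
  interpret finite_measure "lebesgue_on \<Omega>"
    using assms by (intro finite_measure_lebesgue_on lmeasurable_open)
  have const: "(\<lambda>x. 1 :: real) \<in> L2 \<Omega>"
    by (simp add: L2_def)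
  show ?thesis
  proof (rule L2I_dominated[OF _ const, where B = B])
    show "f \<in> borel_measurable (lebesgue_on \<Omega>)"
      using assms by (intro continuous_imp_measurable_on_sets_lebesgue) (auto intro: continuous_on_subset)
    show "AE x in lebesgue_on \<Omega>. norm (f x) \<le> B * norm (1::real)"
      using B closure_subset by (intro AE_I2) auto
  qed
qed

context
  fixes \<Omega> :: "(real^'d) set"
  assumes \<Omega>: "open \<Omega>" "bounded \<Omega>"
begin

lemma test_function_L2:
  assumes "test_function \<Omega> \<phi>"
  shows "\<phi> \<in> L2 \<Omega>" "(\<lambda>x. frechet_derivative \<phi> (at x) (axis j 1)) \<in> L2 \<Omega>"
  using test_function_smooth[OF assms]
  by (auto intro!: continuous_L2 \<Omega> smooth_continuous smooth_continuous_partial)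

lemma is_weak_grad_add:
  assumes "v \<in> L2 \<Omega>" "w \<in> L2 \<Omega>" "G \<in> L2 \<Omega>" "H \<in> L2 \<Omega>" "is_weak_grad \<Omega> v G" "is_weak_grad \<Omega> w H"
  shows "is_weak_grad \<Omega> (\<lambda>x. v x + w x) (\<lambda>x. G x + H x)"
  using assms
  by (simp add: is_weak_grad_iff_l2_inner l2_inner_add_left L2_vec_nth test_function_L2)

lemma is_weak_grad_scaleR:
  assumes "is_weak_grad \<Omega> v G"
  shows "is_weak_grad \<Omega> (\<lambda>x. c *\<^sub>R v x) (\<lambda>x. c *\<^sub>R G x)"
  using assms by (simp add: is_weak_grad_def mult.assoc)

text \<open>\<^const>\<open>weak_grad\<close> is an arbitrary choice among the weak gradients, so uniqueness almost everywhere is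
what makes it, and with it the strain, linear almost everywhere.\<close>

lemma is_weak_grad_unique:
  assumes L2: "G \<in> L2 \<Omega>" "H \<in> L2 \<Omega>" and "is_weak_grad \<Omega> v G" "is_weak_grad \<Omega> v H"
  shows "AE x in lebesgue_on \<Omega>. G x = H x"
proof -
  have "AE x in lebesgue_on \<Omega>. G x $ i $ j - H x $ i $ j = 0" for i j
  proof (rule fundamental_lemma_of_variations[OF \<Omega>(1)])
    have D: "(\<lambda>x. G x $ i $ j - H x $ i $ j) \<in> L2 \<Omega>"
      by (intro L2_diff L2_vec_nth L2)
    have one: "(\<lambda>x. 1 :: real) \<in> L2 \<Omega>"
      by (rule continuous_L2[OF \<Omega>]) simp
    show "integrable (lebesgue_on \<Omega>) (\<lambda>x. G x $ i $ j - H x $ i $ j)"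
      using integrable_inner_L2[OF D one] by simp
    fix \<phi> assume \<phi>: "test_function \<Omega> \<phi>"
    have "l2_inner \<Omega> (\<lambda>x. G x $ i $ j - H x $ i $ j) \<phi> = 0"
      using assms \<phi>
      by (subst l2_inner_diff_left) (simp_all add: L2_vec_nth test_function_L2 is_weak_grad_iff_l2_inner)
    then show "(LINT x|lebesgue_on \<Omega>. (G x $ i $ j - H x $ i $ j) * \<phi> x) = 0"
      by (simp add: l2_inner_def)
  qed
  then have "AE x in lebesgue_on \<Omega>. \<forall>i j. G x $ i $ j - H x $ i $ j = 0"
    by (simp add: AE_all_countable)
  then show ?thesis by (simp add: vec_eq_iff)
qed

lemma H1D:
  assumes "v \<in> H1 \<Omega>"
  shows "v \<in> L2 \<Omega>" "weak_grad \<Omega> v \<in> L2 \<Omega>" "is_weak_grad \<Omega> v (weak_grad \<Omega> v)"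
proof -
  have "\<exists>G. G \<in> L2 \<Omega> \<and> is_weak_grad \<Omega> v G" using assms by (auto simp: H1_def)
  from someI_ex[OF this] show "weak_grad \<Omega> v \<in> L2 \<Omega>" "is_weak_grad \<Omega> v (weak_grad \<Omega> v)"
    by (auto simp: weak_grad_def)
qed (use assms in \<open>simp add: H1_def\<close>)

lemma weak_grad_eqI:
  assumes "v \<in> L2 \<Omega>" "G \<in> L2 \<Omega>" "is_weak_grad \<Omega> v G"
  shows "v \<in> H1 \<Omega>" "AE x in lebesgue_on \<Omega>. weak_grad \<Omega> v x = G x"
proof -
  show v: "v \<in> H1 \<Omega>" using assms by (auto simp: H1_def)
  show "AE x in lebesgue_on \<Omega>. weak_grad \<Omega> v x = G x"
    by (rule is_weak_grad_unique[OF H1D(2)[OF v] assms(2) H1D(3)[OF v] assms(3)])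
qed

lemma weak_grad_add:
  assumes "v \<in> H1 \<Omega>" "w \<in> H1 \<Omega>"
  shows "(\<lambda>x. v x + w x) \<in> H1 \<Omega>"
    "AE x in lebesgue_on \<Omega>. weak_grad \<Omega> (\<lambda>x. v x + w x) x = weak_grad \<Omega> v x + weak_grad \<Omega> w x"
proof -
  have "(\<lambda>x. v x + w x) \<in> L2 \<Omega>" "(\<lambda>x. weak_grad \<Omega> v x + weak_grad \<Omega> w x) \<in> L2 \<Omega>"
    "is_weak_grad \<Omega> (\<lambda>x. v x + w x) (\<lambda>x. weak_grad \<Omega> v x + weak_grad \<Omega> w x)"
    by (intro L2_add is_weak_grad_add H1D assms)+
  from weak_grad_eqI[OF this] show "(\<lambda>x. v x + w x) \<in> H1 \<Omega>"
    "AE x in lebesgue_on \<Omega>. weak_grad \<Omega> (\<lambda>x. v x + w x) x = weak_grad \<Omega> v x + weak_grad \<Omega> w x" .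
qed

lemma weak_grad_scaleR:
  assumes "v \<in> H1 \<Omega>"
  shows "(\<lambda>x. c *\<^sub>R v x) \<in> H1 \<Omega>"
    "AE x in lebesgue_on \<Omega>. weak_grad \<Omega> (\<lambda>x. c *\<^sub>R v x) x = c *\<^sub>R weak_grad \<Omega> v x"
proof -
  have "(\<lambda>x. c *\<^sub>R v x) \<in> L2 \<Omega>" "(\<lambda>x. c *\<^sub>R weak_grad \<Omega> v x) \<in> L2 \<Omega>"
    "is_weak_grad \<Omega> (\<lambda>x. c *\<^sub>R v x) (\<lambda>x. c *\<^sub>R weak_grad \<Omega> v x)"
    by (intro L2_scaleR is_weak_grad_scaleR H1D assms)+
  from weak_grad_eqI[OF this] show "(\<lambda>x. c *\<^sub>R v x) \<in> H1 \<Omega>"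
    "AE x in lebesgue_on \<Omega>. weak_grad \<Omega> (\<lambda>x. c *\<^sub>R v x) x = c *\<^sub>R weak_grad \<Omega> v x" .
qed

lemma weak_grad_zero:
  "(\<lambda>x. 0) \<in> H1 \<Omega>" "AE x in lebesgue_on \<Omega>. weak_grad \<Omega> (\<lambda>x. 0) x = 0"
proof -
  have "is_weak_grad \<Omega> (\<lambda>x. 0) (\<lambda>x. 0)"
    by (simp add: is_weak_grad_def)
  from weak_grad_eqI[OF L2_zero L2_zero this] show "(\<lambda>x. 0) \<in> H1 \<Omega>"
    "AE x in lebesgue_on \<Omega>. weak_grad \<Omega> (\<lambda>x. 0) x = 0" .
qed

lemma strain_L2: "v \<in> H1 \<Omega> \<Longrightarrow> strain \<Omega> v \<in> L2 \<Omega>"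
  unfolding strain_def[abs_def]
proof (intro L2_scaleR L2_add H1D(2))
  assume v: "v \<in> H1 \<Omega>"
  have "linear (transpose :: real^'d^'d \<Rightarrow> _)"
    by (rule linearI) (simp_all add: transpose_def vec_eq_iff)
  then show "(\<lambda>x. transpose (weak_grad \<Omega> v x)) \<in> L2 \<Omega>"
    by (intro L2_bounded_linear[OF H1D(2)[OF v]]) (simp add: linear_conv_bounded_linear)
qed

lemma strain_symmetric: "strain \<Omega> v x \<in> sym_matrices"
  by (simp add: strain_def sym_matrices_def transpose_def vec_eq_iff)

lemma strain_scaleR:
  "v \<in> H1 \<Omega> \<Longrightarrow> AE x in lebesgue_on \<Omega>. strain \<Omega> (\<lambda>x. c *\<^sub>R v x) x = c *\<^sub>R strain \<Omega> v x"
  using weak_grad_scaleR(2)[of v c]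
  by (rule AE_mp) (auto intro!: AE_I2 simp: strain_def transpose_def vec_eq_iff distrib_left mult_ac)

section \<open>Traces and loads\<close>

lemma sets_surface_measure: "sets surface_measure = sets borel"
  unfolding surface_measure_def hausdorff_measure_def
  by (metis sets_measure_of_conv sets.sigma_sets_eq space_borel subset_UNIV Pow_UNIV)

text \<open>The integral of nonnegative functions is additive on measurable functions only; that the surface
measure lives on the Borel \<open>\<sigma>\<close>-algebra makes both summands measurable.\<close>

lemma boundary_integral_add_le:
  fixes a b :: "real^'d \<Rightarrow> real^'d"
  assumes [measurable]: "a \<in> borel_measurable borel" "b \<in> borel_measurable borel" "A \<in> sets borel"
  shows "(\<integral>\<^sup>+x\<in>A. ennreal ((norm (a x + b x))\<^sup>2) \<partial>surface_measure)
    \<le> 2 * (\<integral>\<^sup>+x\<in>A. ennreal ((norm (a x))\<^sup>2) \<partial>surface_measure)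
      + 2 * (\<integral>\<^sup>+x\<in>A. ennreal ((norm (b x))\<^sup>2) \<partial>surface_measure)"
proof -
  have meas: "(\<lambda>x. ennreal ((norm (c x))\<^sup>2) * indicator A x) \<in> borel_measurable surface_measure"
    if [measurable]: "c \<in> borel_measurable borel" for c :: "real^'d \<Rightarrow> real^'d"
    unfolding measurable_cong_sets[OF sets_surface_measure refl] by measurable
  have "ennreal ((norm (a x + b x))\<^sup>2) * indicator A x
      \<le> 2 * (ennreal ((norm (a x))\<^sup>2) * indicator A x) + 2 * (ennreal ((norm (b x))\<^sup>2) * indicator A x)" for x
  proof -
    have "ennreal ((norm (a x + b x))\<^sup>2) \<le> ennreal (2 * (norm (a x))\<^sup>2 + 2 * (norm (b x))\<^sup>2)"
      by (intro ennreal_leI norm_add_square_le)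
    also have "\<dots> = 2 * ennreal ((norm (a x))\<^sup>2) + 2 * ennreal ((norm (b x))\<^sup>2)"
      by (simp add: ennreal_mult)
    finally show ?thesis by (simp add: indicator_def)
  qed
  then have "(\<integral>\<^sup>+x\<in>A. ennreal ((norm (a x + b x))\<^sup>2) \<partial>surface_measure)
      \<le> (\<integral>\<^sup>+x. 2 * (ennreal ((norm (a x))\<^sup>2) * indicator A x)
              + 2 * (ennreal ((norm (b x))\<^sup>2) * indicator A x) \<partial>surface_measure)"
    by (intro nn_integral_mono)
  also have "\<dots> = 2 * (\<integral>\<^sup>+x\<in>A. ennreal ((norm (a x))\<^sup>2) \<partial>surface_measure)
      + 2 * (\<integral>\<^sup>+x\<in>A. ennreal ((norm (b x))\<^sup>2) \<partial>surface_measure)"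
    by (subst nn_integral_add) (simp_all add: nn_integral_cmult meas borel_measurable_times_ennreal)
  finally show ?thesis .
qed

lemma boundary_integral_scaleR:
  fixes a :: "real^'d \<Rightarrow> real^'d"
  assumes [measurable]: "a \<in> borel_measurable borel" "A \<in> sets borel"
  shows "(\<integral>\<^sup>+x\<in>A. ennreal ((norm (c *\<^sub>R a x))\<^sup>2) \<partial>surface_measure)
    = ennreal (c\<^sup>2) * (\<integral>\<^sup>+x\<in>A. ennreal ((norm (a x))\<^sup>2) \<partial>surface_measure)"
proof -
  have meas: "(\<lambda>x. ennreal ((norm (a x))\<^sup>2) * indicator A x) \<in> borel_measurable surface_measure"
    unfolding measurable_cong_sets[OF sets_surface_measure refl] by measurable
  show ?thesis
    by (subst nn_integral_cmult[OF meas, symmetric])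
      (simp add: power_mult_distrib ennreal_mult mult.assoc)
qed

text \<open>The sum of two approximating sequences approximates the sum. The gradient of the limit is the sum
of the gradients only almost everywhere, by \<open>is_weak_grad_unique\<close>.\<close>

lemma has_trace_add:
  assumes H1: "v \<in> H1 \<Omega>" "v' \<in> H1 \<Omega>" and tr: "has_trace \<Omega> v w" "has_trace \<Omega> v' w'"
  shows "has_trace \<Omega> (\<lambda>x. v x + v' x) (\<lambda>x. w x + w' x)"
proof -
  obtain \<phi> where \<phi>: "\<And>n. smooth (\<phi> n)"
      "(\<lambda>n. l2_norm \<Omega> (\<lambda>x. \<phi> n x - v x)) \<longlonglongrightarrow> 0"
      "(\<lambda>n. l2_norm \<Omega> (\<lambda>x. jacobian (\<phi> n) (at x) - weak_grad \<Omega> v x)) \<longlonglongrightarrow> 0"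
      "(\<lambda>n. \<integral>\<^sup>+x\<in>frontier \<Omega>. ennreal ((norm (\<phi> n x - w x))\<^sup>2) \<partial>surface_measure) \<longlonglongrightarrow> 0"
    and w: "w \<in> borel_measurable borel"
      "(\<integral>\<^sup>+x\<in>frontier \<Omega>. ennreal ((norm (w x))\<^sup>2) \<partial>surface_measure) < \<infinity>"
    using tr(1) unfolding has_trace_def by blast
  obtain \<psi> where \<psi>: "\<And>n. smooth (\<psi> n)"
      "(\<lambda>n. l2_norm \<Omega> (\<lambda>x. \<psi> n x - v' x)) \<longlonglongrightarrow> 0"
      "(\<lambda>n. l2_norm \<Omega> (\<lambda>x. jacobian (\<psi> n) (at x) - weak_grad \<Omega> v' x)) \<longlonglongrightarrow> 0"
      "(\<lambda>n. \<integral>\<^sup>+x\<in>frontier \<Omega>. ennreal ((norm (\<psi> n x - w' x))\<^sup>2) \<partial>surface_measure) \<longlonglongrightarrow> 0"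
    and w': "w' \<in> borel_measurable borel"
      "(\<integral>\<^sup>+x\<in>frontier \<Omega>. ennreal ((norm (w' x))\<^sup>2) \<partial>surface_measure) < \<infinity>"
    using tr(2) unfolding has_trace_def by blast
  have fr: "frontier \<Omega> \<in> sets borel" by simp
  have borel: "f \<in> borel_measurable borel" if "smooth f" for f :: "real^'d \<Rightarrow> real^'d"
    by (rule borel_measurable_continuous_onI[OF smooth_continuous[OF that]])
  have lim2: "(\<lambda>n. 2 * (a n + b n)) \<longlonglongrightarrow> 0" if "a \<longlonglongrightarrow> 0" "b \<longlonglongrightarrow> 0" for a b :: "nat \<Rightarrow> real"
    using tendsto_mult[OF tendsto_const tendsto_add[OF that], of 2] by simp
  show ?thesis
    unfolding has_trace_def
  proof (intro conjI exI[of _ "\<lambda>n x. \<phi> n x + \<psi> n x"] allI)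
    show "(\<lambda>x. w x + w' x) \<in> borel_measurable borel"
      by (rule borel_measurable_add[OF w(1) w'(1)])
    show "(\<integral>\<^sup>+x\<in>frontier \<Omega>. ennreal ((norm (w x + w' x))\<^sup>2) \<partial>surface_measure) < \<infinity>"
      by (rule le_less_trans[OF boundary_integral_add_le[OF w(1) w'(1) fr]])
        (use w(2) w'(2) in \<open>auto simp: ennreal_mult_less_top\<close>)
    show "smooth (\<lambda>x. \<phi> n x + \<psi> n x)" for n
      by (rule smooth_add[OF \<phi>(1) \<psi>(1)])
    show "(\<lambda>n. l2_norm \<Omega> (\<lambda>x. \<phi> n x + \<psi> n x - (v x + v' x))) \<longlonglongrightarrow> 0"
    proof (rule tendsto_sandwich[OF _ _ tendsto_const lim2[OF \<phi>(2) \<psi>(2)]])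
      show "\<forall>\<^sub>F n in sequentially. l2_norm \<Omega> (\<lambda>x. \<phi> n x + \<psi> n x - (v x + v' x))
          \<le> 2 * (l2_norm \<Omega> (\<lambda>x. \<phi> n x - v x) + l2_norm \<Omega> (\<lambda>x. \<psi> n x - v' x))"
        using l2_norm_add_le[OF L2_diff[OF continuous_L2[OF \<Omega> smooth_continuous[OF \<phi>(1)]] H1D(1)[OF H1(1)]]
            L2_diff[OF continuous_L2[OF \<Omega> smooth_continuous[OF \<psi>(1)]] H1D(1)[OF H1(2)]]]
        by (simp add: algebra_simps)
    qed (simp add: l2_norm_def l2_inner_self_nonneg)
    show "(\<lambda>n. l2_norm \<Omega> (\<lambda>x. jacobian (\<lambda>x. \<phi> n x + \<psi> n x) (at x)
        - weak_grad \<Omega> (\<lambda>x. v x + v' x) x)) \<longlonglongrightarrow> 0"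
    proof (rule tendsto_sandwich[OF _ _ tendsto_const lim2[OF \<phi>(3) \<psi>(3)]])
      have A: "(\<lambda>x. jacobian (\<phi> n) (at x) - weak_grad \<Omega> v x) \<in> L2 \<Omega>" for n
        by (intro L2_diff continuous_L2[OF \<Omega>] continuous_jacobian \<phi> H1D H1)
      have B: "(\<lambda>x. jacobian (\<psi> n) (at x) - weak_grad \<Omega> v' x) \<in> L2 \<Omega>" for n
        by (intro L2_diff continuous_L2[OF \<Omega>] continuous_jacobian \<psi> H1D H1)
      have "l2_norm \<Omega> (\<lambda>x. jacobian (\<lambda>x. \<phi> n x + \<psi> n x) (at x) - weak_grad \<Omega> (\<lambda>x. v x + v' x) x)
          = l2_norm \<Omega> (\<lambda>x. (jacobian (\<phi> n) (at x) - weak_grad \<Omega> v x)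
              + (jacobian (\<psi> n) (at x) - weak_grad \<Omega> v' x))" for n
      proof (rule l2_norm_cong[OF _ L2_add[OF A B]])
        show "(\<lambda>x. jacobian (\<lambda>x. \<phi> n x + \<psi> n x) (at x) - weak_grad \<Omega> (\<lambda>x. v x + v' x) x) \<in> L2 \<Omega>"
          by (intro L2_diff continuous_L2[OF \<Omega>] continuous_jacobian smooth_add \<phi> \<psi> H1D weak_grad_add H1)
        show "AE x in lebesgue_on \<Omega>.
            jacobian (\<lambda>x. \<phi> n x + \<psi> n x) (at x) - weak_grad \<Omega> (\<lambda>x. v x + v' x) x
            = (jacobian (\<phi> n) (at x) - weak_grad \<Omega> v x) + (jacobian (\<psi> n) (at x) - weak_grad \<Omega> v' x)"
          using weak_grad_add(2)[OF H1]
          by eventually_elim (simp add: jacobian_add[OF \<phi>(1) \<psi>(1)])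
      qed
      then show "\<forall>\<^sub>F n in sequentially.
          l2_norm \<Omega> (\<lambda>x. jacobian (\<lambda>x. \<phi> n x + \<psi> n x) (at x) - weak_grad \<Omega> (\<lambda>x. v x + v' x) x)
          \<le> 2 * (l2_norm \<Omega> (\<lambda>x. jacobian (\<phi> n) (at x) - weak_grad \<Omega> v x)
            + l2_norm \<Omega> (\<lambda>x. jacobian (\<psi> n) (at x) - weak_grad \<Omega> v' x))"
        using l2_norm_add_le[OF A B] by simp
    qed (simp add: l2_norm_def l2_inner_self_nonneg)
    show "(\<lambda>n. \<integral>\<^sup>+x\<in>frontier \<Omega>. ennreal ((norm (\<phi> n x + \<psi> n x - (w x + w' x)))\<^sup>2) \<partial>surface_measure) \<longlonglongrightarrow> 0"
    proof (rule tendsto_sandwich[OF _ _ tendsto_const])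
      show "(\<lambda>n. 2 * (\<integral>\<^sup>+x\<in>frontier \<Omega>. ennreal ((norm (\<phi> n x - w x))\<^sup>2) \<partial>surface_measure)
          + 2 * (\<integral>\<^sup>+x\<in>frontier \<Omega>. ennreal ((norm (\<psi> n x - w' x))\<^sup>2) \<partial>surface_measure)) \<longlonglongrightarrow> 0"
        using tendsto_add[OF ennreal_tendsto_cmult[OF _ \<phi>(4), of 2] ennreal_tendsto_cmult[OF _ \<psi>(4), of 2]]
        by simp
      have eq: "\<phi> n x + \<psi> n x - (w x + w' x) = (\<phi> n x - w x) + (\<psi> n x - w' x)" for n x
        by simp
      show "\<forall>\<^sub>F n in sequentially.
          (\<integral>\<^sup>+x\<in>frontier \<Omega>. ennreal ((norm (\<phi> n x + \<psi> n x - (w x + w' x)))\<^sup>2) \<partial>surface_measure)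
          \<le> 2 * (\<integral>\<^sup>+x\<in>frontier \<Omega>. ennreal ((norm (\<phi> n x - w x))\<^sup>2) \<partial>surface_measure)
            + 2 * (\<integral>\<^sup>+x\<in>frontier \<Omega>. ennreal ((norm (\<psi> n x - w' x))\<^sup>2) \<partial>surface_measure)"
        unfolding eq
        by (intro always_eventually allI boundary_integral_add_le borel_measurable_diff borel \<phi> \<psi> w w' fr)
    qed simp
  qed
qed

lemma has_trace_scaleR:
  assumes H1: "v \<in> H1 \<Omega>" and tr: "has_trace \<Omega> v w"
  shows "has_trace \<Omega> (\<lambda>x. c *\<^sub>R v x) (\<lambda>x. c *\<^sub>R w x)"
proof -
  obtain \<phi> where \<phi>: "\<And>n. smooth (\<phi> n)"
      "(\<lambda>n. l2_norm \<Omega> (\<lambda>x. \<phi> n x - v x)) \<longlonglongrightarrow> 0"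
      "(\<lambda>n. l2_norm \<Omega> (\<lambda>x. jacobian (\<phi> n) (at x) - weak_grad \<Omega> v x)) \<longlonglongrightarrow> 0"
      "(\<lambda>n. \<integral>\<^sup>+x\<in>frontier \<Omega>. ennreal ((norm (\<phi> n x - w x))\<^sup>2) \<partial>surface_measure) \<longlonglongrightarrow> 0"
    and w: "w \<in> borel_measurable borel"
      "(\<integral>\<^sup>+x\<in>frontier \<Omega>. ennreal ((norm (w x))\<^sup>2) \<partial>surface_measure) < \<infinity>"
    using tr unfolding has_trace_def by blast
  have fr: "frontier \<Omega> \<in> sets borel" by simp
  have borel: "f \<in> borel_measurable borel" if "smooth f" for f :: "real^'d \<Rightarrow> real^'d"
    by (rule borel_measurable_continuous_onI[OF smooth_continuous[OF that]])
  have lim: "(\<lambda>n. \<bar>c\<bar> * a n) \<longlonglongrightarrow> 0" if "a \<longlonglongrightarrow> 0" for a :: "nat \<Rightarrow> real"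
    using tendsto_mult[OF tendsto_const that, of "\<bar>c\<bar>"] by simp
  show ?thesis
    unfolding has_trace_def
  proof (intro conjI exI[of _ "\<lambda>n x. c *\<^sub>R \<phi> n x"] allI)
    show "(\<lambda>x. c *\<^sub>R w x) \<in> borel_measurable borel"
      using w(1) by measurable
    show "(\<integral>\<^sup>+x\<in>frontier \<Omega>. ennreal ((norm (c *\<^sub>R w x))\<^sup>2) \<partial>surface_measure) < \<infinity>"
      unfolding boundary_integral_scaleR[OF w(1) fr] using w(2) by (simp add: ennreal_mult_less_top)
    show "smooth (\<lambda>x. c *\<^sub>R \<phi> n x)" for n
      by (rule smooth_scaleR[OF \<phi>(1)])
    show "(\<lambda>n. l2_norm \<Omega> (\<lambda>x. c *\<^sub>R \<phi> n x - c *\<^sub>R v x)) \<longlonglongrightarrow> 0"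
      using lim[OF \<phi>(2)] by (simp add: l2_norm_scaleR flip: scaleR_diff_right)
    have "l2_norm \<Omega> (\<lambda>x. jacobian (\<lambda>x. c *\<^sub>R \<phi> n x) (at x) - weak_grad \<Omega> (\<lambda>x. c *\<^sub>R v x) x)
        = l2_norm \<Omega> (\<lambda>x. c *\<^sub>R (jacobian (\<phi> n) (at x) - weak_grad \<Omega> v x))" for n
    proof (rule l2_norm_cong)
      show "(\<lambda>x. jacobian (\<lambda>x. c *\<^sub>R \<phi> n x) (at x) - weak_grad \<Omega> (\<lambda>x. c *\<^sub>R v x) x) \<in> L2 \<Omega>"
        by (intro L2_diff continuous_L2[OF \<Omega>] continuous_jacobian smooth_scaleR \<phi> H1D weak_grad_scaleR H1)
      show "(\<lambda>x. c *\<^sub>R (jacobian (\<phi> n) (at x) - weak_grad \<Omega> v x)) \<in> L2 \<Omega>"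
        by (intro L2_scaleR L2_diff continuous_L2[OF \<Omega>] continuous_jacobian \<phi> H1D H1)
      show "AE x in lebesgue_on \<Omega>. jacobian (\<lambda>x. c *\<^sub>R \<phi> n x) (at x) - weak_grad \<Omega> (\<lambda>x. c *\<^sub>R v x) x
          = c *\<^sub>R (jacobian (\<phi> n) (at x) - weak_grad \<Omega> v x)"
        using weak_grad_scaleR(2)[OF H1, of c]
        by eventually_elim (simp add: jacobian_scaleR[OF \<phi>(1)] scaleR_diff_right)
    qed
    then show "(\<lambda>n. l2_norm \<Omega> (\<lambda>x. jacobian (\<lambda>x. c *\<^sub>R \<phi> n x) (at x)
        - weak_grad \<Omega> (\<lambda>x. c *\<^sub>R v x) x)) \<longlonglongrightarrow> 0"
      using lim[OF \<phi>(3)] by (simp add: l2_norm_scaleR)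
    have "(\<integral>\<^sup>+x\<in>frontier \<Omega>. ennreal ((norm (c *\<^sub>R \<phi> n x - c *\<^sub>R w x))\<^sup>2) \<partial>surface_measure)
        = ennreal (c\<^sup>2) * (\<integral>\<^sup>+x\<in>frontier \<Omega>. ennreal ((norm (\<phi> n x - w x))\<^sup>2) \<partial>surface_measure)" for n
      unfolding scaleR_diff_right[symmetric]
      by (intro boundary_integral_scaleR borel_measurable_diff borel \<phi> w fr)
    then show "(\<lambda>n. \<integral>\<^sup>+x\<in>frontier \<Omega>. ennreal ((norm (c *\<^sub>R \<phi> n x - c *\<^sub>R w x))\<^sup>2) \<partial>surface_measure) \<longlonglongrightarrow> 0"
      using ennreal_tendsto_cmult[OF _ \<phi>(4), of "ennreal (c\<^sup>2)"] by simp
  qed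
qed

lemma has_trace_zero: "has_trace \<Omega> (\<lambda>x. 0) (\<lambda>x. 0)"
proof -
  have jac: "jacobian (\<lambda>x :: real^'d. 0 :: real^'d) (at x) = 0" for x
    by (simp add: vec_eq_iff jacobian_entry)
  have "AE x in lebesgue_on \<Omega>. - weak_grad \<Omega> (\<lambda>x. 0) x = 0"
    using weak_grad_zero(2) by eventually_elim simp
  then have "l2_norm \<Omega> (\<lambda>x. - weak_grad \<Omega> (\<lambda>x. 0) x) = 0"
    by (simp add: l2_norm_def l2_inner_null)
  moreover have "smooth (\<lambda>x :: real^'d. 0 :: real^'d)"
    by (simp add: smooth_def continuously_differentiable_const)
  ultimately show ?thesis
    unfolding has_trace_def
    by (intro conjI exI[of _ "\<lambda>n x. 0"]) (simp_all add: jac l2_norm_def l2_inner_def)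
qed

lemma V_space_H1: "v \<in> V_space \<Omega> \<Gamma>D \<Longrightarrow> v \<in> H1 \<Omega>"
  by (simp add: V_space_def)

lemma function_subspace_V_space: "function_subspace (V_space \<Omega> \<Gamma>D)"
  unfolding function_subspace_def
proof (intro conjI ballI allI)
  show "(\<lambda>x. 0) \<in> V_space \<Omega> \<Gamma>D"
    using has_trace_zero weak_grad_zero(1) by (auto simp: V_space_def)
  show "(\<lambda>x. v x + v' x) \<in> V_space \<Omega> \<Gamma>D" if "v \<in> V_space \<Omega> \<Gamma>D" "v' \<in> V_space \<Omega> \<Gamma>D" for v v'
  proof -
    obtain w w' where w: "has_trace \<Omega> v w" "AE x in surface_measure. x \<in> \<Gamma>D \<longrightarrow> w x = 0"
      and w': "has_trace \<Omega> v' w'" "AE x in surface_measure. x \<in> \<Gamma>D \<longrightarrow> w' x = 0"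
      using \<open>v \<in> _\<close> \<open>v' \<in> _\<close> by (auto simp: V_space_def)
    have "AE x in surface_measure. x \<in> \<Gamma>D \<longrightarrow> w x + w' x = 0"
      using w(2) w'(2) by eventually_elim simp
    then show ?thesis
      using has_trace_add[OF V_space_H1[OF that(1)] V_space_H1[OF that(2)] w(1) w'(1)]
        weak_grad_add(1)[OF V_space_H1[OF that(1)] V_space_H1[OF that(2)]]
      unfolding V_space_def by blast
  qed
  show "(\<lambda>x. c *\<^sub>R v x) \<in> V_space \<Omega> \<Gamma>D" if "v \<in> V_space \<Omega> \<Gamma>D" for c v
  proof -
    obtain w where w: "has_trace \<Omega> v w" "AE x in surface_measure. x \<in> \<Gamma>D \<longrightarrow> w x = 0"
      using \<open>v \<in> _\<close> by (auto simp: V_space_def)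
    have "AE x in surface_measure. x \<in> \<Gamma>D \<longrightarrow> c *\<^sub>R w x = 0"
      using w(2) by eventually_elim simp
    then show ?thesis
      using has_trace_scaleR[OF V_space_H1[OF that] w(1)] weak_grad_scaleR(1)[OF V_space_H1[OF that]]
      unfolding V_space_def by blast
  qed
qed

lemma trace_space_memI:
  "v \<in> V_space \<Omega> \<Gamma>D \<Longrightarrow> has_trace \<Omega> v w \<Longrightarrow> w \<in> trace_space \<Omega> \<Gamma>D"
  unfolding trace_space_def trace_on_def by blast

text \<open>The difference of two traces of \<open>v\<close> is a trace of \<open>v - v = 0\<close>. The quotient norm of a trace of \<open>0\<close> is
at most the \<open>H\<^sup>1\<close> norm of \<open>0\<close>, so a functional bounded in that norm cannot distinguish the two.\<close>

lemma trace_functional_well_defined: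
  assumes g: "bounded_functional (trace_space \<Omega> \<Gamma>D) (trace_norm \<Omega> \<Gamma>D) g"
    and v: "v \<in> V_space \<Omega> \<Gamma>D" and w: "has_trace \<Omega> v w" "has_trace \<Omega> v w'"
  shows "g w = g w'"
proof -
  note V = function_subspaceD[OF function_subspace_V_space[of \<Gamma>D]]
  let ?d = "\<lambda>x. w x + (- 1) *\<^sub>R w' x"
  have neg: "has_trace \<Omega> (\<lambda>x. (- 1) *\<^sub>R v x) (\<lambda>x. (- 1) *\<^sub>R w' x)"
    by (rule has_trace_scaleR[OF V_space_H1[OF v] w(2)])
  have "has_trace \<Omega> (\<lambda>x. v x + (- 1) *\<^sub>R v x) ?d"
    by (rule has_trace_add[OF V_space_H1[OF v] V_space_H1[OF V(3)[OF v]] w(1) neg])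
  then have d: "has_trace \<Omega> (\<lambda>x. 0) ?d" by simp
  have d_in: "?d \<in> trace_space \<Omega> \<Gamma>D"
    by (rule trace_space_memI[OF V(1) d])
  \<comment> \<open>the trace norm of \<open>w - w'\<close> is an infimum over a set of lifts that contains \<open>0\<close>\<close>
  have "trace_norm \<Omega> \<Gamma>D ?d \<le> h1_norm \<Omega> (\<lambda>x. 0)"
    unfolding trace_norm_def
  proof (rule cInf_lower)
    show "h1_norm \<Omega> (\<lambda>x. 0) \<in> h1_norm \<Omega> ` {v \<in> V_space \<Omega> \<Gamma>D. trace_on \<Omega> (frontier \<Omega> - \<Gamma>D) v ?d}"
      using d V(1) unfolding trace_on_def by blast
    show "bdd_below (h1_norm \<Omega> ` {v \<in> V_space \<Omega> \<Gamma>D. trace_on \<Omega> (frontier \<Omega> - \<Gamma>D) v ?d})"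
      by (rule bdd_belowI2[of _ 0]) (simp add: h1_norm_def)
  qed
  moreover have "h1_norm \<Omega> (\<lambda>x. 0) = 0"
    using weak_grad_zero(2) by (simp add: h1_norm_def l2_norm_def l2_inner_null)
  moreover have "0 \<le> trace_norm \<Omega> \<Gamma>D ?d"
    unfolding trace_norm_def
    by (rule cInf_greatest) (use d V(1) in \<open>auto simp: trace_on_def h1_norm_def\<close>)
  ultimately have "trace_norm \<Omega> \<Gamma>D ?d = 0" by simp
  then have "g ?d = 0"
    using g d_in unfolding bounded_functional_def by (metis abs_le_zero_iff mult_zero_right)
  moreover have "w \<in> trace_space \<Omega> \<Gamma>D" "w' \<in> trace_space \<Omega> \<Gamma>D" "(\<lambda>x. (- 1) *\<^sub>R w' x) \<in> trace_space \<Omega> \<Gamma>D"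
    using trace_space_memI[OF v] w trace_space_memI[OF V(3)[OF v] neg] by auto
  then have "g ?d = g w + (- 1) * g w'"
    using g unfolding bounded_functional_def by metis
  then have "g ?d = g w - g w'" by simp
  ultimately show ?thesis by simp
qed

text \<open>\<^const>\<open>boundary_trace\<close> picks an arbitrary trace and need not be homogeneous itself; \<open>g\<close> does not notice.\<close>

lemma load_scaleR:
  assumes f: "bounded_functional (V_space \<Omega> \<Gamma>D) (h1_norm \<Omega>) f"
    and g: "bounded_functional (trace_space \<Omega> \<Gamma>D) (trace_norm \<Omega> \<Gamma>D) g"
    and v: "v \<in> V_space \<Omega> \<Gamma>D"
  shows "load \<Omega> f g (\<lambda>x. c *\<^sub>R v x) = c * load \<Omega> f g v"
proof -
  have tr: "has_trace \<Omega> u (boundary_trace \<Omega> u)" if "u \<in> V_space \<Omega> \<Gamma>D" for u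
  proof -
    have "\<exists>w. has_trace \<Omega> u w" using that by (auto simp: V_space_def)
    then show ?thesis unfolding boundary_trace_def by (rule someI_ex)
  qed
  have cv: "(\<lambda>x. c *\<^sub>R v x) \<in> V_space \<Omega> \<Gamma>D"
    by (rule function_subspaceD(3)[OF function_subspace_V_space v])
  have "g (boundary_trace \<Omega> (\<lambda>x. c *\<^sub>R v x)) = g (\<lambda>x. c *\<^sub>R boundary_trace \<Omega> v x)"
    by (rule trace_functional_well_defined[OF g cv tr[OF cv] has_trace_scaleR[OF V_space_H1[OF v] tr[OF v]]])
  also have "\<dots> = c * g (boundary_trace \<Omega> v)"
    using g trace_space_memI[OF v tr[OF v]] unfolding bounded_functional_def by blast
  finally show ?thesis
    using f v unfolding load_def bounded_functional_def by (simp add: distrib_left)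
qed

end

section \<open>Material tensors\<close>

lemma sym_matrices_iff: "\<tau> \<in> sym_matrices \<longleftrightarrow> (\<forall>i j. \<tau> $ i $ j = \<tau> $ j $ i)"
  by (auto simp: sym_matrices_def transpose_def vec_eq_iff)

lemma subspace_sym_matrices: "subspace sym_matrices"
  by (simp add: subspace_def sym_matrices_iff)

text \<open>The symmetrised matrix unit with entries at the pair \<open>p\<close> and its transpose. A material tensor is
linear on symmetric matrices only, so the usual matrix units cannot serve for expanding its argument.\<close>

definition sym_unit :: "'d \<times> 'd \<Rightarrow> real^'d^'d" where
  "sym_unit p = (\<chi> k l. ((if (k, l) = p then 1 else 0) + (if (l, k) = p then 1 else 0)) / 2)"

lemma sym_unit_symmetric: "sym_unit p \<in> sym_matrices"
  by (simp add: sym_matrices_iff sym_unit_def)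

lemma sym_matrix_expansion:
  fixes \<tau> :: "real^'d^'d"
  assumes "\<tau> \<in> sym_matrices"
  shows "\<tau> = (\<Sum>p\<in>UNIV. \<tau> $ fst p $ snd p *\<^sub>R sym_unit p)"
proof -
  have "\<tau> $ k $ l = (\<Sum>p\<in>UNIV. \<tau> $ fst p $ snd p *\<^sub>R sym_unit p) $ k $ l" for k l
  proof -
    have "(\<Sum>p\<in>UNIV. \<tau> $ fst p $ snd p *\<^sub>R sym_unit p) $ k $ l
        = (\<Sum>p\<in>UNIV. (if (k, l) = p then \<tau> $ k $ l / 2 else 0)
            + (if (l, k) = p then \<tau> $ l $ k / 2 else 0))"
      unfolding sum_component by (rule sum.cong) (auto simp: sym_unit_def add_divide_distrib distrib_left)
    also have "\<dots> = \<tau> $ k $ l / 2 + \<tau> $ l $ k / 2"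
      by (simp only: sum.distrib sum.delta' finite_UNIV UNIV_I if_True) simp
    also have "\<tau> $ l $ k = \<tau> $ k $ l"
      using assms unfolding sym_matrices_iff by blast
    finally show ?thesis by simp
  qed
  then show ?thesis unfolding vec_eq_iff by blast
qed

lemma material_tensorD:
  assumes "material_tensor \<Omega> A" "\<tau> \<in> sym_matrices"
  shows "x \<in> \<Omega> \<Longrightarrow> \<rho> \<in> sym_matrices \<Longrightarrow> A x (\<tau> + \<rho>) = A x \<tau> + A x \<rho>"
    "x \<in> \<Omega> \<Longrightarrow> A x (c *\<^sub>R \<tau>) = c *\<^sub>R A x \<tau>"
    "(\<lambda>x. A x \<tau>) \<in> borel_measurable (lebesgue_on \<Omega>)"
proof -
  have *: "\<forall>x\<in>\<Omega>. (\<forall>\<tau>\<in>sym_matrices. \<forall>\<rho>\<in>sym_matrices. A x (\<tau> + \<rho>) = A x \<tau> + A x \<rho>) \<and>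
      (\<forall>c. \<forall>\<tau>\<in>sym_matrices. A x (c *\<^sub>R \<tau>) = c *\<^sub>R A x \<tau>)"
    and **: "\<forall>\<tau>\<in>sym_matrices. (\<lambda>x. A x \<tau>) \<in> borel_measurable (lebesgue_on \<Omega>)"
    using assms(1) unfolding material_tensor_def by (elim conjE; fast)+
  show "x \<in> \<Omega> \<Longrightarrow> \<rho> \<in> sym_matrices \<Longrightarrow> A x (\<tau> + \<rho>) = A x \<tau> + A x \<rho>"
    "x \<in> \<Omega> \<Longrightarrow> A x (c *\<^sub>R \<tau>) = c *\<^sub>R A x \<tau>"
    "(\<lambda>x. A x \<tau>) \<in> borel_measurable (lebesgue_on \<Omega>)"
    using * ** assms(2) by fast+
qed

lemma material_tensor_sum:
  assumes A: "material_tensor \<Omega> A" and "x \<in> \<Omega>" "finite I" "\<And>i. i \<in> I \<Longrightarrow> S i \<in> sym_matrices"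
  shows "A x (\<Sum>i\<in>I. c i *\<^sub>R S i) = (\<Sum>i\<in>I. c i *\<^sub>R A x (S i))"
  using assms(3,4)
proof (induction I rule: finite_induct)
  case empty
  have "A x (0 *\<^sub>R 0) = 0 *\<^sub>R A x 0"
    by (rule material_tensorD(2)[OF A subspace_0[OF subspace_sym_matrices] assms(2)])
  then show ?case by simp
next
  case (insert i I)
  have S: "c i *\<^sub>R S i \<in> sym_matrices" "(\<Sum>i\<in>I. c i *\<^sub>R S i) \<in> sym_matrices"
    using insert.prems by (auto intro!: subspace_sum subspace_scale subspace_sym_matrices)
  show ?case
    using insert material_tensorD(1)[OF A S(1) assms(2) S(2)]
      material_tensorD(2)[OF A insert.prems[OF insertI1] assms(2), of "c i"]
    by simp
qed

text \<open>Measurability is known for a constant argument only; expanding \<open>\<tau> x\<close> in the matrices \<^const>\<open>sym_unit\<close>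
moves the dependence on \<open>x\<close> into scalar coefficients.\<close>

lemma L2_material_tensor:
  fixes \<tau> :: "real^'d \<Rightarrow> real^'d^'d"
  assumes A: "material_tensor \<Omega> A" and \<tau>: "\<tau> \<in> L2 \<Omega>" and sym: "\<And>x. x \<in> \<Omega> \<Longrightarrow> \<tau> x \<in> sym_matrices"
  shows "(\<lambda>x. A x (\<tau> x)) \<in> L2 \<Omega>"
proof -
  have comp: "A x (\<tau> x) = (\<Sum>p\<in>UNIV. \<tau> x $ fst p $ snd p *\<^sub>R A x (sym_unit p))" if "x \<in> \<Omega>" for x
    using material_tensor_sum[OF A that, of UNIV sym_unit "\<lambda>p. \<tau> x $ fst p $ snd p"]
    by (simp add: sym_unit_symmetric flip: sym_matrix_expansion[OF sym[OF that]])
  have "(\<lambda>x. \<Sum>p\<in>UNIV. \<tau> x $ fst p $ snd p *\<^sub>R A x (sym_unit p)) \<in> borel_measurable (lebesgue_on \<Omega>)"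
    by (intro borel_measurable_sum borel_measurable_scaleR L2_measurable[OF L2_vec_nth[OF L2_vec_nth[OF \<tau>]]]
        material_tensorD(3)[OF A sym_unit_symmetric])
  then have meas: "(\<lambda>x. A x (\<tau> x)) \<in> borel_measurable (lebesgue_on \<Omega>)"
    by (subst measurable_lebesgue_cong[OF comp])
  obtain M where M: "AE x in lebesgue_on \<Omega>. \<forall>\<tau>\<in>sym_matrices. norm (A x \<tau>) \<le> M * norm \<tau>"
    using A unfolding material_tensor_def by blast
  have "AE x in lebesgue_on \<Omega>. x \<in> \<Omega>"
    by (rule AE_I2) simp
  with M have "AE x in lebesgue_on \<Omega>. norm (A x (\<tau> x)) \<le> M * norm (\<tau> x)"
    by eventually_elim (use sym in auto)
  with meas \<tau> show ?thesis by (rule L2I_dominated)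
qed

section \<open>The bilinear form\<close>

lemma trace_eq_inner_mat_1: "mat 1 \<bullet> (q :: real^'d^'d) = trace q"
proof -
  have "(\<Sum>j\<in>UNIV. (if i = j then 1 else 0) * q $ i $ j) = (\<Sum>j\<in>UNIV. if i = j then q $ i $ j else 0)" for i
    by (rule sum.cong) auto
  then show ?thesis by (simp add: inner_vec_def mat_def trace_def)
qed

lemma dev_inner_trace_free: "trace q = 0 \<Longrightarrow> dev \<tau> \<bullet> q = \<tau> \<bullet> q"
  by (simp add: dev_def inner_diff_left trace_eq_inner_mat_1)

lemma bounded_linear_dev: "bounded_linear (dev :: real^'d^'d \<Rightarrow> real^'d^'d)"
proof -
  have "linear (dev :: real^'d^'d \<Rightarrow> _)"
    by (rule linearI) (simp_all add: dev_def trace_def sum.distrib sum_distrib_left[symmetric]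
        add_divide_distrib scaleR_add_left scaleR_diff_right)
  then show ?thesis by (simp add: linear_conv_bounded_linear)
qed

lemma L2_dev: "\<tau> \<in> L2 \<Omega> \<Longrightarrow> (\<lambda>x. dev (\<tau> x)) \<in> L2 \<Omega>"
  by (rule L2_bounded_linear[OF _ bounded_linear_dev])

lemma function_subspace_Q_space: "function_subspace (Q_space \<Omega>)"
  by (auto simp: function_subspace_def Q_space_def L2_zero L2_add L2_scaleR sym_matrices_iff
      trace_def sum.distrib sum_distrib_left[symmetric])

lemma Q_space_L2: "q \<in> Q_space \<Omega> \<Longrightarrow> q \<in> L2 \<Omega>"
  by (simp add: Q_space_def)

context
  fixes \<Omega> :: "(real^'d) set" and \<C> \<H> :: "real^'d \<Rightarrow> real^'d^'d \<Rightarrow> real^'d^'d"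
  assumes \<Omega>: "open \<Omega>" "bounded \<Omega>" and tensors: "material_tensor \<Omega> \<C>" "material_tensor \<Omega> \<H>"
begin

lemma L2_stress:
  assumes "u \<in> H1 \<Omega>" "p \<in> Q_space \<Omega>"
  shows "stress \<Omega> \<C> u p \<in> L2 \<Omega>" "(\<lambda>x. \<H> x (p x)) \<in> L2 \<Omega>"
proof -
  show "stress \<Omega> \<C> u p \<in> L2 \<Omega>"
    unfolding stress_def[abs_def]
  proof (rule L2_material_tensor[OF tensors(1)])
    show "(\<lambda>x. strain \<Omega> u x - p x) \<in> L2 \<Omega>"
      by (intro L2_diff strain_L2[OF \<Omega>] Q_space_L2 assms)
    show "strain \<Omega> u x - p x \<in> sym_matrices" if "x \<in> \<Omega>" for x
      using assms that
      by (intro subspace_diff subspace_sym_matrices strain_symmetric[OF \<Omega>]) (simp add: Q_space_def)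
  qed
  show "(\<lambda>x. \<H> x (p x)) \<in> L2 \<Omega>"
    by (rule L2_material_tensor[OF tensors(2)]) (use assms in \<open>auto simp: Q_space_def\<close>)
qed

text \<open>The plastic test function is trace free, so only the deviator of \<open>stress - \<H> p\<close> acts on it. This is
where the right-hand side of the formula for the multiplier comes from.\<close>

lemma bilinear_a_decomposition:
  assumes "u \<in> H1 \<Omega>" "p \<in> Q_space \<Omega>" "v \<in> H1 \<Omega>" "q \<in> Q_space \<Omega>"
  shows "bilinear_a \<Omega> \<C> \<H> (u, p) (v, q) = l2_inner \<Omega> (stress \<Omega> \<C> u p) (strain \<Omega> v)
    - l2_inner \<Omega> (\<lambda>x. dev (stress \<Omega> \<C> u p x - \<H> x (p x))) q"
proof -
  note L2 = L2_stress[OF assms(1,2)] strain_L2[OF \<Omega> assms(3)] Q_space_L2[OF assms(4)]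
  have "l2_inner \<Omega> (\<lambda>x. dev (stress \<Omega> \<C> u p x - \<H> x (p x))) q
      = l2_inner \<Omega> (\<lambda>x. stress \<Omega> \<C> u p x - \<H> x (p x)) q"
    unfolding l2_inner_def
    by (rule Bochner_Integration.integral_cong)
      (use assms(4) in \<open>auto simp: Q_space_def dev_inner_trace_free\<close>)
  also have "\<dots> = l2_inner \<Omega> (stress \<Omega> \<C> u p) q - l2_inner \<Omega> (\<lambda>x. \<H> x (p x)) q"
    using L2 by (simp add: l2_inner_diff_left)
  finally show ?thesis
    using L2 by (simp add: bilinear_a_def l2_inner_diff_right)
qed

end

section \<open>Polynomials on the reference cube\<close>

lemma finite_multi_indices: "finite B \<Longrightarrow> finite {\<alpha> :: 'd::finite \<Rightarrow> 'b. \<forall>i. \<alpha> i \<in> B}"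
  using finite_PiE[of "UNIV :: 'd set" "\<lambda>_. B"] by (simp add: PiE_UNIV_domain Pi_def)

lemma finite_multi_indices_less: "finite {\<alpha> :: 'd::finite \<Rightarrow> nat. \<forall>i. \<alpha> i < n}"
  using finite_multi_indices[of "{..<n}"] by simp

lemma finite_multi_indices_le: "finite {\<alpha> :: 'd::finite \<Rightarrow> nat. \<forall>i. \<alpha> i \<le> n}"
  using finite_multi_indices[of "{..n}"] by simp

lemma poly_spaceE:
  assumes "P \<in> poly_space k"
  obtains c where "P = (\<lambda>x. \<Sum>\<alpha>\<in>{\<alpha>. \<forall>i. \<alpha> i \<le> k}. (\<Prod>i\<in>UNIV. x $ i ^ \<alpha> i) *\<^sub>R c \<alpha>)"
  using assms unfolding poly_space_def by blast

lemma poly_space_add: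
  assumes "P \<in> poly_space k" "P' \<in> poly_space k"
  shows "(\<lambda>x. P x + P' x) \<in> poly_space k"
proof -
  obtain c c' where "P = (\<lambda>x. \<Sum>\<alpha>\<in>{\<alpha>. \<forall>i. \<alpha> i \<le> k}. (\<Prod>i\<in>UNIV. x $ i ^ \<alpha> i) *\<^sub>R c \<alpha>)"
    "P' = (\<lambda>x. \<Sum>\<alpha>\<in>{\<alpha>. \<forall>i. \<alpha> i \<le> k}. (\<Prod>i\<in>UNIV. x $ i ^ \<alpha> i) *\<^sub>R c' \<alpha>)"
    using assms by (elim poly_spaceE)
  then show ?thesis
    unfolding poly_space_def
    by (intro CollectI exI[of _ "\<lambda>\<alpha>. c \<alpha> + c' \<alpha>"]) (simp add: scaleR_add_right sum.distrib)
qed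

lemma poly_space_scaleR:
  assumes "P \<in> poly_space k"
  shows "(\<lambda>x. r *\<^sub>R P x) \<in> poly_space k"
proof -
  obtain c where "P = (\<lambda>x. \<Sum>\<alpha>\<in>{\<alpha>. \<forall>i. \<alpha> i \<le> k}. (\<Prod>i\<in>UNIV. x $ i ^ \<alpha> i) *\<^sub>R c \<alpha>)"
    using assms by (elim poly_spaceE)
  then show ?thesis
    unfolding poly_space_def
    by (intro CollectI exI[of _ "\<lambda>\<alpha>. r *\<^sub>R c \<alpha>"]) (simp add: scaleR_sum_right mult.commute)
qed

lemma poly_space_zero: "(\<lambda>x. 0) \<in> poly_space k"
  unfolding poly_space_def by (intro CollectI exI[of _ "\<lambda>_. 0"]) simp

lemma poly_space_differentiable:
  fixes P :: "real^'d \<Rightarrow> 'b::real_normed_vector"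
  assumes "P \<in> poly_space k"
  shows "P differentiable (at x within S)"
proof -
  obtain c where P: "P = (\<lambda>x. \<Sum>\<alpha>\<in>{\<alpha>. \<forall>i. \<alpha> i \<le> k}. (\<Prod>i\<in>UNIV. x $ i ^ \<alpha> i) *\<^sub>R c \<alpha>)"
    using assms by (elim poly_spaceE)
  have "(\<lambda>x. (\<Prod>i\<in>UNIV. x $ i ^ \<alpha> i) *\<^sub>R c \<alpha>) differentiable (at x within S)" for \<alpha>
    unfolding differentiable_def
    by (rule exI, rule has_derivative_scaleR_left, rule has_derivative_prod, rule has_derivative_power,
      rule bounded_linear_imp_has_derivative[OF bounded_linear_vec_nth])
  then show ?thesis
    unfolding P by (intro differentiable_sum finite_multi_indices_le ballI)
qed

lemma poly_space_continuous:
  fixes P :: "real^'d \<Rightarrow> 'b::real_normed_vector"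
  shows "P \<in> poly_space k \<Longrightarrow> continuous_on S P"
  by (rule differentiable_imp_continuous_on) (simp add: differentiable_on_def poly_space_differentiable)

lemma poly_space_coordinate_line:
  fixes P :: "real^'d \<Rightarrow> 'b::real_inner"
  assumes "P \<in> poly_space k"
  shows "\<exists>p :: real poly. degree p \<le> k \<and> (\<forall>t. poly p t = P (\<chi> i. if i = j then t else x $ i) \<bullet> e)"
proof -
  obtain c where P: "P = (\<lambda>x. \<Sum>\<alpha>\<in>{\<alpha>. \<forall>i. \<alpha> i \<le> k}. (\<Prod>i\<in>UNIV. x $ i ^ \<alpha> i) *\<^sub>R c \<alpha>)"
    using assms by (elim poly_spaceE)
  define p where "p = (\<Sum>\<alpha>\<in>{\<alpha>. \<forall>i. \<alpha> i \<le> k}. monom ((\<Prod>i\<in>UNIV - {j}. x $ i ^ \<alpha> i) * (c \<alpha> \<bullet> e)) (\<alpha> j))"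
  have "degree p \<le> k"
    unfolding p_def
    by (intro degree_sum_le finite_multi_indices_le) (auto intro: order_trans[OF degree_monom_le])
  moreover have "poly p t = P (\<chi> i. if i = j then t else x $ i) \<bullet> e" for t
  proof -
    have "(\<Prod>i\<in>UNIV. (\<chi> i. if i = j then t else x $ i) $ i ^ \<alpha> i) = t ^ \<alpha> j * (\<Prod>i\<in>UNIV - {j}. x $ i ^ \<alpha> i)" for \<alpha>
      by (subst prod.remove[of UNIV j]) (auto intro!: prod.cong)
    then show ?thesis
      unfolding P p_def by (simp add: poly_sum poly_monom inner_sum_left mult_ac)
  qed
  ultimately show ?thesis by blast
qed

text \<open>Coordinates are freed one at a time: along a coordinate line the polynomial has degree at most \<open>k\<close>
and more than \<open>k\<close> zeros. Taking the inner product with a fixed \<open>e\<close> reduces to scalar polynomials;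
at the end \<open>e\<close> is the value itself.\<close>

lemma poly_space_zero_if_zero_on_grid:
  fixes P :: "real^'d \<Rightarrow> 'b::real_inner"
  assumes P: "P \<in> poly_space k" and N: "finite N" "card N > k"
    and grid: "\<And>x. (\<And>i. x $ i \<in> N) \<Longrightarrow> P x = 0"
  shows "P x = 0"
proof -
  have "(\<And>i. i \<notin> J \<Longrightarrow> x $ i \<in> N) \<Longrightarrow> P x \<bullet> e = 0" if "finite J" for J e x
    using that
  proof (induction J arbitrary: x rule: finite_induct)
    case empty
    then show ?case using grid by simp
  next
    case (insert j J)
    obtain p :: "real poly" where p: "degree p \<le> k"
        "\<And>t. poly p t = P (\<chi> i. if i = j then t else x $ i) \<bullet> e"
      using poly_space_coordinate_line[OF P, of j x e] by blast
    have "p = 0"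
    proof (rule ccontr)
      assume "p \<noteq> 0"
      have "poly p t = 0" if "t \<in> N" for t
        unfolding p(2) by (rule insert.IH) (use insert.prems that in auto)
      then have "card N \<le> card {t. poly p t = 0}"
        by (intro card_mono poly_roots_finite \<open>p \<noteq> 0\<close>) auto
      also have "\<dots> \<le> degree p"
        by (rule card_poly_roots_bound[OF \<open>p \<noteq> 0\<close>])
      finally show False using p(1) N(2) by simp
    qed
    moreover have "(\<chi> i. if i = j then x $ j else x $ i) = x"
      by (simp add: vec_eq_iff)
    ultimately show ?case using p(2)[of "x $ j"] by simp
  qed
  from this[of UNIV x "P x"] show ?thesis by simp
qed

section \<open>Gauss nodes\<close>

text \<open>If the node \<open>\<xi> k\<close> were an end point \<open>s\<close> of the interval, then \<open>(1 - s x) \<Prod>\<^bsub>j \<noteq> k\<^esub> (x - \<xi> j)\<^sup>2\<close> would be a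
nonnegative nonzero polynomial of degree \<open>2 n - 1\<close> that vanishes at all nodes, and the rule would not
integrate it exactly. Interior nodes matter because discrete functions are polynomial in the interior
of an element only and are arbitrary on its boundary.\<close>

lemma gauss_node_interior:
  assumes gauss: "gauss_rule n \<xi> \<omega>" and k: "k < n"
  shows "\<xi> k \<in> {-1<..<1}"
proof (rule ccontr)
  assume "\<xi> k \<notin> {-1<..<1}"
  moreover have "\<xi> k \<in> {-1..1}" using gauss k by (simp add: gauss_rule_def)
  ultimately have s: "\<xi> k = 1 \<or> \<xi> k = -1" by auto
  define R where "R = (\<Prod>j\<in>{..<n} - {k}. [:- \<xi> j, 1:])"
  define P where "P = [:1, - \<xi> k:] * R\<^sup>2"
  have "R \<noteq> 0" by (auto simp: R_def)
  moreover have "[:1, - \<xi> k:] \<noteq> 0" by simp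
  ultimately have P0: "P \<noteq> 0"
    unfolding P_def by (simp only: mult_eq_0_iff power_eq_0_iff) simp
  have "degree R \<le> n - 1"
    unfolding R_def using degree_prod_sum_le[of "{..<n} - {k}" "\<lambda>j. [:- \<xi> j, 1:]"] k by simp
  moreover have "degree P \<le> 1 + 2 * degree R"
    unfolding P_def power2_eq_square
    by (intro order_trans[OF degree_mult_le] add_mono) (auto intro: order_trans[OF degree_mult_le])
  ultimately have "degree P \<le> 2 * n - 1" using k by simp
  then have "integral {-1..1} (poly P) = (\<Sum>j<n. \<omega> j * poly P (\<xi> j))"
    using gauss by (simp add: gauss_rule_def)
  also have "\<dots> = 0"
  proof (rule sum.neutral, rule ballI)
    fix j assume "j \<in> {..<n}"
    then have "poly P (\<xi> j) = 0"
      using s by (cases "j = k") (auto simp: P_def R_def poly_prod intro!: prod_zero)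
    then show "\<omega> j * poly P (\<xi> j) = 0" by simp
  qed
  finally have int0: "integral {-1..1} (poly P) = 0" .
  have "poly P x = (1 - \<xi> k * x) * (poly R x)\<^sup>2" for x
    unfolding P_def poly_mult poly_power by (simp add: mult.commute)
  moreover have "0 \<le> 1 - \<xi> k * x" if "x \<in> {-1..1}" for x
    using s that by auto
  ultimately have "0 \<le> poly P x" if "x \<in> {-1..1}" for x
    using that by simp
  then have "\<forall>x\<in>{-1..1}. poly P x = 0"
    using int0 integral_eq_0_iff[of "-1" 1 "poly P"] by (simp add: continuous_on_poly)
  then have "{-1..1} \<subseteq> {x. poly P x = 0}" by auto
  then have "finite {-1..1::real}" using poly_roots_finite[OF P0] finite_subset by blast
  then show False using infinite_Icc[of "-1" "1 :: real"] by simp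
qed

section \<open>Discrete functions on the mesh\<close>

lemma interior_ref_cube: "interior ref_cube = box (-1) 1"
  by (simp add: ref_cube_def)

lemma mesh_element_map_open:
  assumes T: "mesh_element T FT" and U: "open U" "U \<subseteq> interior ref_cube"
  shows "open (FT ` U)"
proof (rule invariance_of_domain[OF _ U(1)])
  show "continuous_on U FT"
    using T by (auto simp: mesh_element_def intro: poly_space_continuous)
  have "U \<subseteq> ref_cube" using U(2) interior_subset by blast
  then show "inj_on FT U"
    using T by (auto simp: mesh_element_def bij_betw_def intro: inj_on_subset)
qed

text \<open>What is left of \<open>T\<close> lies in the image of the boundary of the cube under a differentiable map.\<close>

lemma mesh_element_skeleton_negligible:
  fixes T :: "(real^'d) set"
  assumes "mesh_element T FT"
  shows "negligible (T - FT ` interior ref_cube)"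
proof (rule negligible_subset)
  have "FT \<in> poly_space 1" using assms by (simp add: mesh_element_def)
  then have "FT differentiable_on (ref_cube - interior ref_cube)"
    by (simp add: differentiable_on_def poly_space_differentiable)
  moreover have "negligible (ref_cube - interior ref_cube :: (real^'d) set)"
    unfolding interior_ref_cube unfolding ref_cube_def by (rule negligible_frontier_interval)
  ultimately show "negligible (FT ` (ref_cube - interior ref_cube))"
    by (intro negligible_differentiable_image_negligible) auto
  show "T - FT ` interior ref_cube \<subseteq> FT ` (ref_cube - interior ref_cube)"
    using assms by (auto simp: mesh_element_def bij_betw_def)
qed

lemma AE_lebesgue_on_open_iff:
  fixes \<Omega> :: "'a::euclidean_space set"
  assumes "open \<Omega>"
  shows "(AE x in lebesgue_on \<Omega>. R x) \<longleftrightarrow> negligible {x \<in> \<Omega>. \<not> R x}"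
proof -
  have "(AE x in lebesgue_on \<Omega>. R x) \<longleftrightarrow> (AE x in lebesgue. x \<in> \<Omega> \<longrightarrow> R x)"
    using assms by (intro AE_restrict_space_iff) auto
  also have "\<dots> \<longleftrightarrow> {x \<in> \<Omega>. \<not> R x} \<in> null_sets lebesgue"
    by (simp add: completion.AE_iff_null_sets)
  finally show ?thesis by (simp add: negligible_iff_null_sets)
qed

text \<open>Point values in the interior of elements are determined by the class modulo null sets: if the
polynomial is nonzero at \<open>x0\<close>, it is so near \<open>x0\<close>, and by invariance of domain the image of such a
neighbourhood is open. Being contained in the closure of \<open>\<Omega>\<close>, that open set meets \<open>\<Omega>\<close> in a set of
positive measure.\<close>

lemma piecewise_poly_null_imp_zero:
  fixes q :: "real^'d \<Rightarrow> 'b::real_normed_vector"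
  assumes "open \<Omega>" and mesh: "hp_mesh \<kappa> \<Omega> \<T> F deg" and pp: "piecewise_poly \<T> F k q"
    and null: "AE x in lebesgue_on \<Omega>. q x = 0" and T: "T \<in> \<T>" and x0: "x0 \<in> interior ref_cube"
  shows "q (F T x0) = 0"
proof (rule ccontr)
  assume nz: "q (F T x0) \<noteq> 0"
  have elem: "mesh_element T (F T)" and sub: "T \<subseteq> closure \<Omega>"
    using mesh T by (auto simp: hp_mesh_def)
  obtain P where P: "P \<in> poly_space (k T)" "\<And>x. x \<in> interior ref_cube \<Longrightarrow> q (F T x) = P x"
    using pp T unfolding piecewise_poly_def by blast
  define U where "U = {x \<in> interior ref_cube. P x \<noteq> 0}"
  have "open U"
  proof -
    have "open (interior ref_cube \<inter> P -` (- {0}))"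
      by (intro continuous_open_preimage poly_space_continuous[OF P(1)]) auto
    then show ?thesis by (simp add: U_def vimage_def Int_def)
  qed
  then have W: "open (F T ` U)"
    by (rule mesh_element_map_open[OF elem]) (auto simp: U_def)
  have "F T x0 \<in> F T ` U" using nz P(2)[OF x0] x0 by (auto simp: U_def)
  moreover have "F T ` U \<subseteq> closure \<Omega>"
    using elem sub interior_subset unfolding mesh_element_def bij_betw_def U_def by blast
  ultimately have "F T ` U \<inter> \<Omega> \<noteq> {}"
    using open_Int_closure_eq_empty[OF W, of \<Omega>] by blast
  then have "\<not> negligible (F T ` U \<inter> \<Omega>)"
    by (intro open_not_negligible open_Int W assms(1))
  moreover have "F T ` U \<inter> \<Omega> \<subseteq> {x \<in> \<Omega>. q x \<noteq> 0}"
    using P(2) by (auto simp: U_def)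
  moreover have "negligible {x \<in> \<Omega>. q x \<noteq> 0}"
    using null AE_lebesgue_on_open_iff[OF assms(1), of "\<lambda>x. q x = 0"] by simp
  ultimately show False using negligible_subset by blast
qed

text \<open>Conversely, values on one sufficiently fine interior grid per element determine the function off
the images of the cube boundaries, that is, almost everywhere.\<close>

lemma piecewise_poly_null_if_zero_on_grids:
  fixes q :: "real^'d \<Rightarrow> 'b::real_inner"
  assumes "open \<Omega>" and mesh: "hp_mesh \<kappa> \<Omega> \<T> F deg" and pp: "piecewise_poly \<T> F k q"
    and N: "\<And>T. T \<in> \<T> \<Longrightarrow> finite (N T) \<and> card (N T) > k T \<and> N T \<subseteq> {-1<..<1}"
    and grid: "\<And>T x. T \<in> \<T> \<Longrightarrow> (\<And>i. x $ i \<in> N T) \<Longrightarrow> q (F T x) = 0"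
  shows "AE x in lebesgue_on \<Omega>. q x = 0"
proof -
  have zero: "q (F T x) = 0" if T: "T \<in> \<T>" and x: "x \<in> interior ref_cube" for T x
  proof -
    obtain P where P: "P \<in> poly_space (k T)" "\<And>x. x \<in> interior ref_cube \<Longrightarrow> q (F T x) = P x"
      using pp T unfolding piecewise_poly_def by blast
    have "P x = 0"
    proof (rule poly_space_zero_if_zero_on_grid[OF P(1)])
      fix x :: "real^'d" assume g: "\<And>i. x $ i \<in> N T"
      then have "x \<in> interior ref_cube"
        using N[OF T] unfolding interior_ref_cube mem_box_cart by fastforce
      then show "P x = 0" using P(2) grid[OF T g] by simp
    qed (use N[OF T] in auto)
    then show ?thesis using P(2)[OF x] by simp
  qed
  have "negligible (\<Union>T\<in>\<T>. T - F T ` interior ref_cube)"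
  proof (intro negligible_Union)
    show "finite ((\<lambda>T. T - F T ` interior ref_cube) ` \<T>)" using mesh by (simp add: hp_mesh_def)
    fix X assume "X \<in> (\<lambda>T. T - F T ` interior ref_cube) ` \<T>"
    then obtain T where "T \<in> \<T>" "X = T - F T ` interior ref_cube" by blast
    then show "negligible X"
      using mesh mesh_element_skeleton_negligible[of T "F T"] by (simp add: hp_mesh_def)
  qed
  moreover have "{x \<in> \<Omega>. q x \<noteq> 0} \<subseteq> (\<Union>T\<in>\<T>. T - F T ` interior ref_cube)"
  proof
    fix x assume x: "x \<in> {x \<in> \<Omega>. q x \<noteq> 0}"
    then have "x \<in> \<Union>\<T>" using mesh closure_subset by (auto simp: hp_mesh_def)
    with x zero show "x \<in> (\<Union>T\<in>\<T>. T - F T ` interior ref_cube)" by auto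
  qed
  ultimately show ?thesis
    using negligible_subset AE_lebesgue_on_open_iff[OF assms(1)] by blast
qed

section \<open>The discrete plasticity functional\<close>

text \<open>The special rule for \<open>n = 1\<close> fits the same pattern, as there is then exactly one multi-index, \<open>0\<close>.\<close>

lemma quadrature_elem_weighted_sum:
  fixes FT :: "real^'d \<Rightarrow> real^'d"
  assumes gauss: "gauss_rule n (\<xi> n) (\<omega> n)" and n: "n \<ge> 1"
  shows "\<exists>w z. (\<forall>k\<in>{k :: 'd \<Rightarrow> nat. \<forall>i. k i < n}. 0 \<le> w k \<and> z k \<in> interior ref_cube) \<and>
    (\<forall>f. quadrature_elem \<xi> \<omega> T FT n f = (\<Sum>k\<in>{k. \<forall>i. k i < n}. w k * f (FT (z k))))"
proof (cases "n = 1")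
  case True
  have "{k :: 'd \<Rightarrow> nat. \<forall>i. k i < n} = {\<lambda>i. 0}" using True by auto
  then show ?thesis
    using True
    by (intro exI[of _ "\<lambda>k. measure lebesgue T"] exI[of _ "\<lambda>k. 0"])
      (simp add: quadrature_elem_def interior_ref_cube mem_box_cart)
next
  case False
  have "0 \<le> (\<Prod>i\<in>UNIV. \<omega> n (k i)) * \<bar>det (jacobian FT (at (\<chi> i. \<xi> n (k i))))\<bar>"
    if "\<forall>i. k i < n" for k :: "'d \<Rightarrow> nat"
    using gauss that by (intro mult_nonneg_nonneg prod_nonneg) (auto simp: gauss_rule_def less_imp_le)
  moreover have "(\<chi> i. \<xi> n (k i)) \<in> interior ref_cube" if "\<forall>i. k i < n" for k :: "'d \<Rightarrow> nat"
    using gauss_node_interior[OF gauss] that by (simp add: interior_ref_cube mem_box_cart)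
  ultimately show ?thesis
    using False
    by (intro exI[of _ "\<lambda>k. (\<Prod>i\<in>UNIV. \<omega> n (k i)) * \<bar>det (jacobian FT (at (\<chi> i. \<xi> n (k i))))\<bar>"]
        exI[of _ "\<lambda>k. \<chi> i. \<xi> n (k i)"])
      (simp add: quadrature_elem_def Let_def)
qed

lemma psi_hp_weighted_sum:
  fixes F :: "(real^'d) set \<Rightarrow> real^'d \<Rightarrow> real^'d"
  assumes mesh: "hp_mesh \<kappa> \<Omega> \<T> F deg" and gauss: "\<And>n. n \<ge> 1 \<Longrightarrow> gauss_rule n (\<xi> n) (\<omega> n)"
    and "\<sigma>y > 0"
  obtains I :: "((real^'d) set \<times> ('d \<Rightarrow> nat)) set" and w z where
    "finite I" "\<And>i. i \<in> I \<Longrightarrow> 0 \<le> w i"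
    "\<And>i. i \<in> I \<Longrightarrow> \<exists>T\<in>\<T>. \<exists>x\<in>interior ref_cube. z i = F T x"
    "\<And>q. psi_hp \<T> F deg \<xi> \<omega> \<sigma>y q = (\<Sum>i\<in>I. w i * norm (q (z i)))"
proof -
  let ?K = "\<lambda>T. {k :: 'd \<Rightarrow> nat. \<forall>i. k i < deg T}"
  have deg: "deg T \<ge> 1" if "T \<in> \<T>" for T using mesh that by (auto simp: hp_mesh_def)
  let ?R = "\<lambda>T w z. (\<forall>k\<in>?K T. 0 \<le> w k \<and> z k \<in> interior ref_cube) \<and>
      (\<forall>f. quadrature_elem \<xi> \<omega> T (F T) (deg T) f = (\<Sum>k\<in>?K T. w k * f (F T (z k))))"
  have "\<forall>T\<in>\<T>. \<exists>w z. ?R T w z"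
    by (intro ballI quadrature_elem_weighted_sum gauss deg)
  from bchoice[OF this] obtain w where w: "\<forall>T\<in>\<T>. \<exists>z. ?R T (w T) z" ..
  from bchoice[OF w] obtain z where z: "\<forall>T\<in>\<T>. ?R T (w T) (z T)" ..
  have wz: "0 \<le> w T k \<and> z T k \<in> interior ref_cube" if "T \<in> \<T>" "k \<in> ?K T" for T k
    using bspec[OF z that(1), THEN conjunct1] that(2) by blast
  have sum: "quadrature_elem \<xi> \<omega> T (F T) (deg T) f = (\<Sum>k\<in>?K T. w T k * f (F T (z T k)))"
    if "T \<in> \<T>" for T f
    using bspec[OF z that, THEN conjunct2] by blast
  show thesis
  proof (rule that)
    show "finite (Sigma \<T> ?K)"
      using mesh finite_multi_indices_less by (intro finite_SigmaI) (auto simp: hp_mesh_def)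
    show "0 \<le> \<sigma>y * w (fst i) (snd i)" if "i \<in> Sigma \<T> ?K" for i
      using wz that \<open>\<sigma>y > 0\<close> by (intro mult_nonneg_nonneg) auto
    show "\<exists>T\<in>\<T>. \<exists>x\<in>interior ref_cube. F (fst i) (z (fst i) (snd i)) = F T x" if "i \<in> Sigma \<T> ?K" for i
      using wz that by (intro bexI[of _ "fst i"] bexI[of _ "z (fst i) (snd i)"]) auto
    show "psi_hp \<T> F deg \<xi> \<omega> \<sigma>y q
        = (\<Sum>i\<in>Sigma \<T> ?K. \<sigma>y * w (fst i) (snd i) * norm (q (F (fst i) (z (fst i) (snd i)))))" for q
    proof -
      have "psi_hp \<T> F deg \<xi> \<omega> \<sigma>y q
          = (\<Sum>T\<in>\<T>. \<Sum>k\<in>?K T. \<sigma>y * w T k * norm (q (F T (z T k))))"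
        unfolding psi_hp_def by (rule sum.cong) (simp_all add: sum mult_ac)
      also have "\<dots> = (\<Sum>(T, k)\<in>Sigma \<T> ?K. \<sigma>y * w T k * norm (q (F T (z T k))))"
        using mesh finite_multi_indices_less by (intro sum.Sigma) (auto simp: hp_mesh_def)
      finally show ?thesis by (simp add: case_prod_unfold)
    qed
  qed
qed

section \<open>The space of discrete plastic strains\<close>

lemma function_subspace_Int:
  "function_subspace S \<Longrightarrow> function_subspace S' \<Longrightarrow> function_subspace (S \<inter> S')"
  by (simp add: function_subspace_def)

lemma function_subspace_piecewise_poly:
  fixes \<T> :: "(real^'d) set set"
  shows "function_subspace {q :: real^'d \<Rightarrow> 'b::real_vector. piecewise_poly \<T> F k q}"
proof -
  have "piecewise_poly \<T> F k (\<lambda>x. 0 :: 'b)"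
    using poly_space_zero unfolding piecewise_poly_def by (intro ballI bexI[of _ "\<lambda>x. 0"]) auto
  moreover have "piecewise_poly \<T> F k (\<lambda>x. q x + r x)"
    if "piecewise_poly \<T> F k q" "piecewise_poly \<T> F k r" for q r :: "real^'d \<Rightarrow> 'b"
    using that poly_space_add unfolding piecewise_poly_def by fastforce
  moreover have "piecewise_poly \<T> F k (\<lambda>x. c *\<^sub>R q x)"
    if "piecewise_poly \<T> F k q" for c and q :: "real^'d \<Rightarrow> 'b"
    using that poly_space_scaleR unfolding piecewise_poly_def by fastforce
  ultimately show ?thesis by (simp add: function_subspace_def)
qed

lemma function_subspace_Q_hp: "function_subspace (Q_hp \<Omega> \<T> F deg)"
  using function_subspace_Int[OF function_subspace_Q_space function_subspace_piecewise_poly]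
  by (simp add: Q_hp_def Int_def)

lemma function_subspace_V_hp:
  assumes "open \<Omega>" "bounded \<Omega>"
  shows "function_subspace (V_hp \<Omega> \<Gamma>D \<T> F deg)"
  using function_subspace_Int[OF function_subspace_V_space[OF assms] function_subspace_piecewise_poly]
  by (simp add: V_hp_def Int_def)

lemma Q_hp_L2: "Q_hp \<Omega> \<T> F deg \<subseteq> L2 \<Omega>"
  by (auto simp: Q_hp_def Q_space_def)

text \<open>The determining functionals are the entries of the values at the Gauss points; \<open>deg T\<close> nodes per
direction suffice for degree \<open>deg T - 1\<close>.\<close>

lemma riesz_representation_Q_hp:
  fixes F :: "(real^'d) set \<Rightarrow> real^'d \<Rightarrow> real^'d"
  assumes "open \<Omega>" and mesh: "hp_mesh \<kappa> \<Omega> \<T> F deg"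
    and gauss: "\<And>n. n \<ge> 1 \<Longrightarrow> gauss_rule n (\<xi> n) (\<omega> n)"
    and "linear_functional (Q_hp \<Omega> \<T> F deg) \<phi>"
    and "\<And>q. q \<in> Q_hp \<Omega> \<T> F deg \<Longrightarrow> AE x in lebesgue_on \<Omega>. q x = 0 \<Longrightarrow> \<phi> q = 0"
  shows "\<exists>\<mu>\<in>Q_hp \<Omega> \<T> F deg. \<forall>q\<in>Q_hp \<Omega> \<T> F deg. l2_inner \<Omega> \<mu> q = \<phi> q"
proof (rule riesz_representation_finitely_determined[OF _ function_subspace_Q_hp Q_hp_L2 _ _ assms(4,5)])
  define J where "J = (SIGMA T:\<T>. {k :: 'd \<Rightarrow> nat. \<forall>i. k i < deg T} \<times> (Basis :: (real^'d^'d) set))"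
  define ev where "ev = (\<lambda>(T, k, e) (q :: real^'d \<Rightarrow> real^'d^'d). q (F T (\<chi> i. \<xi> (deg T) (k i))) \<bullet> e)"
  show "finite J"
    unfolding J_def using mesh finite_multi_indices_less
    by (intro finite_SigmaI finite_cartesian_product) (auto simp: hp_mesh_def)
  show "linear_functional (Q_hp \<Omega> \<T> F deg) (ev j)" if "j \<in> J" for j
    by (cases j) (simp add: ev_def linear_functional_def inner_add_left)
  fix q assume q: "q \<in> Q_hp \<Omega> \<T> F deg" and ev0: "\<And>j. j \<in> J \<Longrightarrow> ev j q = 0"
  show "AE x in lebesgue_on \<Omega>. q x = 0"
  proof (rule piecewise_poly_null_if_zero_on_grids[OF assms(1) mesh])
    show "piecewise_poly \<T> F (\<lambda>T. deg T - 1) q" using q by (simp add: Q_hp_def)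
    fix T assume T: "T \<in> \<T>"
    have deg: "deg T \<ge> 1" using mesh T by (auto simp: hp_mesh_def)
    note G = gauss[OF deg]
    have "card (\<xi> (deg T) ` {..<deg T}) = deg T"
      using G by (subst card_image) (auto simp: gauss_rule_def)
    then show "finite (\<xi> (deg T) ` {..<deg T}) \<and> card (\<xi> (deg T) ` {..<deg T}) > deg T - 1 \<and>
        \<xi> (deg T) ` {..<deg T} \<subseteq> {-1<..<1}"
      using deg gauss_node_interior[OF G] by auto
    fix x :: "real^'d" assume "\<And>i. x $ i \<in> \<xi> (deg T) ` {..<deg T}"
    then have "\<forall>i. \<exists>k. k < deg T \<and> x $ i = \<xi> (deg T) k" by blast
    then obtain k where k: "\<And>i. k i < deg T" "\<And>i. x $ i = \<xi> (deg T) (k i)" by metis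
    then have x: "x = (\<chi> i. \<xi> (deg T) (k i))" by (simp add: vec_eq_iff)
    have "\<forall>e\<in>Basis. q (F T x) \<bullet> e = 0"
    proof
      fix e :: "real^'d^'d" assume "e \<in> Basis"
      then show "q (F T x) \<bullet> e = 0"
        using ev0[of "(T, k, e)"] T k(1) by (simp add: J_def ev_def x)
    qed
    then show "q (F T x) = 0" unfolding euclidean_all_zero_iff .
  qed
qed

lemma l2_projection_Q_hp:
  fixes F :: "(real^'d) set \<Rightarrow> real^'d \<Rightarrow> real^'d"
  assumes "open \<Omega>" "hp_mesh \<kappa> \<Omega> \<T> F deg" "\<And>n. n \<ge> 1 \<Longrightarrow> gauss_rule n (\<xi> n) (\<omega> n)" and f: "f \<in> L2 \<Omega>"
  shows "l2_projection \<Omega> (Q_hp \<Omega> \<T> F deg) f \<in> Q_hp \<Omega> \<T> F deg"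
    and "q \<in> Q_hp \<Omega> \<T> F deg \<Longrightarrow>
      l2_inner \<Omega> (l2_projection \<Omega> (Q_hp \<Omega> \<T> F deg) f) q = l2_inner \<Omega> f q"
proof -
  let ?Q = "Q_hp \<Omega> \<T> F deg"
  have L2: "q \<in> L2 \<Omega>" if "q \<in> ?Q" for q using that Q_hp_L2 by blast
  have diff: "l2_inner \<Omega> (\<lambda>x. f x - g x) r = l2_inner \<Omega> f r - l2_inner \<Omega> g r"
    if "g \<in> ?Q" "r \<in> ?Q" for g r
    by (intro l2_inner_diff_left f L2 that)
  have "l2_inner \<Omega> f q = 0" if "AE x in lebesgue_on \<Omega>. q x = 0" for q
    using l2_inner_null[OF that] by (simp add: l2_inner_commute)
  then obtain \<mu> where "\<mu> \<in> ?Q" "\<forall>q\<in>?Q. l2_inner \<Omega> \<mu> q = l2_inner \<Omega> f q"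
    using riesz_representation_Q_hp[OF assms(1-3) linear_functional_l2_inner[OF Q_hp_L2 f]] by blast
  then have "\<exists>g. g \<in> ?Q \<and> (\<forall>r\<in>?Q. l2_inner \<Omega> (\<lambda>x. f x - g x) r = 0)"
    using diff by (intro exI[of _ \<mu>]) auto
  from someI_ex[OF this] have P: "l2_projection \<Omega> ?Q f \<in> ?Q"
      "\<forall>r\<in>?Q. l2_inner \<Omega> (\<lambda>x. f x - l2_projection \<Omega> ?Q f x) r = 0"
    unfolding l2_projection_def by auto
  show "l2_projection \<Omega> ?Q f \<in> ?Q" by (rule P(1))
  show "l2_inner \<Omega> (l2_projection \<Omega> ?Q f) q = l2_inner \<Omega> f q" if "q \<in> ?Q"
    using P(2) diff[OF P(1) that] that by simp
qed

text \<open>\<open>Lambda_hp\<close> is the subdifferential of \<open>psi_hp\<close> at \<open>0\<close>, and \<open>psi_hp\<close> is a sum of weighted norms of point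
values. A subgradient at \<open>p\<close> can therefore be written down: replace each norm by the inner product
with the normalised value of \<open>p\<close>. By Cauchy--Schwarz this functional lies below \<open>psi_hp\<close>, with
equality at \<open>p\<close>; the Riesz representation turns it into an element of \<open>Q_hp\<close>. The value
\<open>sgn 0 = 0\<close> takes care of points where \<open>p\<close> vanishes.\<close>

lemma Lambda_hp_attains_psi_hp:
  fixes F :: "(real^'d) set \<Rightarrow> real^'d \<Rightarrow> real^'d"
  assumes "open \<Omega>" and mesh: "hp_mesh \<kappa> \<Omega> \<T> F deg"
    and gauss: "\<And>n. n \<ge> 1 \<Longrightarrow> gauss_rule n (\<xi> n) (\<omega> n)" and "\<sigma>y > 0"
  shows "\<exists>\<mu>\<in>Lambda_hp \<Omega> (Q_hp \<Omega> \<T> F deg) (psi_hp \<T> F deg \<xi> \<omega> \<sigma>y).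
    p \<in> Q_hp \<Omega> \<T> F deg \<longrightarrow> l2_inner \<Omega> \<mu> p = psi_hp \<T> F deg \<xi> \<omega> \<sigma>y p"
proof -
  let ?Q = "Q_hp \<Omega> \<T> F deg"
  obtain I :: "((real^'d) set \<times> ('d \<Rightarrow> nat)) set" and w z where I: "finite I" "\<And>i. i \<in> I \<Longrightarrow> 0 \<le> w i"
      "\<And>i. i \<in> I \<Longrightarrow> \<exists>T\<in>\<T>. \<exists>x\<in>interior ref_cube. z i = F T x"
    and psi: "\<And>q. psi_hp \<T> F deg \<xi> \<omega> \<sigma>y q = (\<Sum>i\<in>I. w i * norm (q (z i)))"
    by (rule psi_hp_weighted_sum[OF mesh gauss \<open>\<sigma>y > 0\<close>]) blast+
  define \<phi> where "\<phi> q = (\<Sum>i\<in>I. w i * (sgn (p (z i)) \<bullet> q (z i)))" for q :: "real^'d \<Rightarrow> real^'d^'d"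
  have "linear_functional ?Q \<phi>"
    by (simp add: linear_functional_def \<phi>_def inner_add_right distrib_left sum.distrib
        sum_distrib_left mult.left_commute)
  moreover have "\<phi> q = 0" if "q \<in> ?Q" "AE x in lebesgue_on \<Omega>. q x = 0" for q
  proof -
    have "q (z i) = 0" if "i \<in> I" for i
      using I(3)[OF that] piecewise_poly_null_imp_zero[OF assms(1) mesh _ \<open>AE x in lebesgue_on \<Omega>. q x = 0\<close>]
        \<open>q \<in> ?Q\<close> by (auto simp: Q_hp_def)
    then show ?thesis by (simp add: \<phi>_def)
  qed
  ultimately obtain \<mu> where \<mu>: "\<mu> \<in> ?Q" "\<forall>q\<in>?Q. l2_inner \<Omega> \<mu> q = \<phi> q"
    using riesz_representation_Q_hp[OF assms(1) mesh gauss] by blast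
  have "\<phi> q \<le> psi_hp \<T> F deg \<xi> \<omega> \<sigma>y q" for q
    unfolding \<phi>_def psi
  proof (intro sum_mono mult_left_mono I(2))
    fix i
    have "sgn (p (z i)) \<bullet> q (z i) \<le> norm (sgn (p (z i))) * norm (q (z i))"
      by (rule norm_cauchy_schwarz)
    also have "\<dots> \<le> 1 * norm (q (z i))"
      by (intro mult_right_mono) (auto simp: norm_sgn)
    finally show "sgn (p (z i)) \<bullet> q (z i) \<le> norm (q (z i))" by simp
  qed
  moreover have "sgn y \<bullet> y = norm y" for y :: "real^'d^'d"
    by (cases "y = 0") (simp_all add: sgn_div_norm power2_eq_square flip: power2_norm_eq_inner)
  then have "\<phi> p = psi_hp \<T> F deg \<xi> \<omega> \<sigma>y p"
    by (simp add: \<phi>_def psi)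
  ultimately show ?thesis
    using \<mu> by (intro bexI[of _ \<mu>]) (auto simp: Lambda_hp_def)
qed

lemma psi_hp_scaleR:
  assumes "c \<ge> 0"
  shows "psi_hp \<T> F deg \<xi> \<omega> \<sigma>y (\<lambda>x. c *\<^sub>R q x) = c * psi_hp \<T> F deg \<xi> \<omega> \<sigma>y q"
  using assms
  by (simp add: psi_hp_def quadrature_elem_def Let_def sum_distrib_left mult_ac if_distrib[of "\<lambda>t. c * t"]
      cong: if_cong sum.cong)

section \<open>Equivalence of the two discrete problems\<close>

theorem theorem2:
  fixes \<Omega> \<Gamma>D :: "(real^'d) set"
    and \<C> \<H> :: "real^'d \<Rightarrow> real^'d^'d \<Rightarrow> real^'d^'d"
    and \<sigma>y \<kappa> :: real
    and f g :: "(real^'d \<Rightarrow> real^'d) \<Rightarrow> real"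
    and \<T> :: "(real^'d) set set"
    and F :: "(real^'d) set \<Rightarrow> real^'d \<Rightarrow> real^'d"
    and deg :: "(real^'d) set \<Rightarrow> nat"
    and \<xi> \<omega> :: "nat \<Rightarrow> nat \<Rightarrow> real"
  assumes "CARD('d) \<in> {2, 3}"
    and "polyhedral_lipschitz_domain \<Omega>"
    and "closed \<Gamma>D" "\<Gamma>D \<subseteq> frontier \<Omega>" "emeasure surface_measure \<Gamma>D > 0"
    and "material_tensor \<Omega> \<C>" "material_tensor \<Omega> \<H>"
    and "\<sigma>y > 0"
    and "bounded_functional (V_space \<Omega> \<Gamma>D) (h1_norm \<Omega>) f"
    and "bounded_functional (trace_space \<Omega> \<Gamma>D) (trace_norm \<Omega> \<Gamma>D) g"
    and "hp_mesh \<kappa> \<Omega> \<T> F deg"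
    and "\<And>n. n \<ge> 1 \<Longrightarrow> gauss_rule n (\<xi> n) (\<omega> n)"
  shows
    "let Vh = V_hp \<Omega> \<Gamma>D \<T> F deg;
         Qh = Q_hp \<Omega> \<T> F deg;
         a = bilinear_a \<Omega> \<C> \<H>;
         l = load \<Omega> f g;
         \<psi> = psi_hp \<T> F deg \<xi> \<omega> \<sigma>y;
         \<Lambda> = Lambda_hp \<Omega> Qh \<psi>;
         L = (\<lambda>u p. l2_projection \<Omega> Qh (\<lambda>x. dev (stress \<Omega> \<C> u p x - \<H> x (p x))))
     in (\<forall>u p. solves_VI a l \<psi> Vh Qh u p \<longrightarrow> solves_mixed \<Omega> a l Vh Qh \<Lambda> u p (L u p)) \<and>
        (\<forall>u p lam. solves_mixed \<Omega> a l Vh Qh \<Lambda> u p lam \<longrightarrow>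
           solves_VI a l \<psi> Vh Qh u p \<and> (AE x in lebesgue_on \<Omega>. lam x = L u p x))"
proof -
  define Vh where "Vh = V_hp \<Omega> \<Gamma>D \<T> F deg"
  define Qh where "Qh = Q_hp \<Omega> \<T> F deg"
  define a where "a = bilinear_a \<Omega> \<C> \<H>"
  define l where "l = load \<Omega> f g"
  define \<psi> where "\<psi> = psi_hp \<T> F deg \<xi> \<omega> \<sigma>y"
  define \<Lambda> where "\<Lambda> = Lambda_hp \<Omega> Qh \<psi>"
  define L where "L = (\<lambda>u p. l2_projection \<Omega> Qh (\<lambda>x. dev (stress \<Omega> \<C> u p x - \<H> x (p x))))"
  define E where "E = (\<lambda>u p v. l2_inner \<Omega> (stress \<Omega> \<C> u p) (strain \<Omega> v))"
  note mesh = assms(11) and gauss = assms(12)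
  have \<Omega>: "open \<Omega>" "bounded \<Omega>"
    using assms(2) by (auto simp: polyhedral_lipschitz_domain_def)
  note V = function_subspaceD[OF function_subspace_V_hp[OF \<Omega>, of \<Gamma>D \<T> F deg, folded Vh_def]]
  note Q = function_subspaceD[OF function_subspace_Q_hp[of \<Omega> \<T> F deg, folded Qh_def]]
  have VV: "v \<in> V_space \<Omega> \<Gamma>D" if "v \<in> Vh" for v using that by (simp add: Vh_def V_hp_def)
  have VH1: "v \<in> H1 \<Omega>" if "v \<in> Vh" for v using V_space_H1[OF \<Omega> VV[OF that]] .
  have QQ: "q \<in> Q_space \<Omega>" if "q \<in> Qh" for q using that by (simp add: Qh_def Q_hp_def)
  have QL2: "q \<in> L2 \<Omega>" if "q \<in> Qh" for q by (rule Q_space_L2[OF QQ[OF that]])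
  have l_scale: "l (\<lambda>x. c *\<^sub>R v x) = c * l v" if "v \<in> Vh" for c v
    unfolding l_def by (rule load_scaleR[OF \<Omega> assms(9,10) VV[OF that]])
  have E_scale: "E u p (\<lambda>x. c *\<^sub>R v x) = c * E u p v" if "u \<in> Vh" "p \<in> Qh" "v \<in> Vh" for c u p v
  proof -
    have "E u p (\<lambda>x. c *\<^sub>R v x) = l2_inner \<Omega> (stress \<Omega> \<C> u p) (\<lambda>x. c *\<^sub>R strain \<Omega> v x)"
      unfolding E_def
      using L2_stress(1)[OF \<Omega> assms(6,7) VH1[OF that(1)] QQ[OF that(2)]] strain_L2[OF \<Omega> VH1[OF that(3)]]
        strain_L2[OF \<Omega> weak_grad_scaleR(1)[OF \<Omega> VH1[OF that(3)]]] strain_scaleR[OF \<Omega> VH1[OF that(3)]]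
      by (intro l2_inner_cong L2_scaleR) auto
    then show ?thesis by (simp add: E_def l2_inner_scaleR_right)
  qed
  have rhs_L2: "(\<lambda>x. dev (stress \<Omega> \<C> u p x - \<H> x (p x))) \<in> L2 \<Omega>" if "u \<in> Vh" "p \<in> Qh" for u p
    by (intro L2_dev L2_diff L2_stress[OF \<Omega> assms(6,7) VH1[OF that(1)] QQ[OF that(2)]])
  have L_in: "L u p \<in> Qh" if "u \<in> Vh" "p \<in> Qh" for u p
    unfolding L_def Qh_def using rhs_L2[OF that] l2_projection_Q_hp(1)[OF \<Omega>(1) mesh gauss] by blast
  have a_eq: "a (u, p) (v, q) = E u p v - l2_inner \<Omega> (L u p) q"
    if "u \<in> Vh" "p \<in> Qh" "v \<in> Vh" "q \<in> Qh" for u p v q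
  proof -
    have "l2_inner \<Omega> (L u p) q = l2_inner \<Omega> (\<lambda>x. dev (stress \<Omega> \<C> u p x - \<H> x (p x))) q"
      unfolding L_def Qh_def
      using l2_projection_Q_hp(2)[OF \<Omega>(1) mesh gauss rhs_L2[OF that(1,2)]] that(4) by (simp add: Qh_def)
    then show ?thesis
      using bilinear_a_decomposition[OF \<Omega> assms(6,7) VH1[OF that(1)] QQ[OF that(2)] VH1[OF that(3)] QQ[OF that(4)]]
      by (simp add: a_def E_def)
  qed
  have l0: "l (\<lambda>x. 0) = 0" using l_scale[OF V(1), of 0] by simp
  have E0: "E u p (\<lambda>x. 0) = 0" if "u \<in> Vh" "p \<in> Qh" for u p
    using E_scale[OF that V(1), of 0] by simp
  have \<psi>_scale: "\<psi> (\<lambda>x. c *\<^sub>R q x) = c * \<psi> q" if "c \<ge> 0" for c q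
    unfolding \<psi>_def by (rule psi_hp_scaleR[OF that])
  have inner_diff: "l2_inner \<Omega> (\<lambda>x. \<mu> x - \<nu> x) q = l2_inner \<Omega> \<mu> q - l2_inner \<Omega> \<nu> q"
      "l2_inner \<Omega> q (\<lambda>x. \<mu> x - \<nu> x) = l2_inner \<Omega> q \<mu> - l2_inner \<Omega> q \<nu>"
    if "\<mu> \<in> Qh" "\<nu> \<in> Qh" "q \<in> Qh" for \<mu> \<nu> q
    by (intro l2_inner_diff_left l2_inner_diff_right QL2 that)+

  \<comment> \<open>The inequality decouples: arbitrary multiples of a displacement give an equation, and the rest
    says that \<open>L u p\<close> is a subgradient of the positively homogeneous \<open>\<psi>\<close> at \<open>p\<close>.\<close>
  have VI_imp_mixed: "solves_mixed \<Omega> a l Vh Qh \<Lambda> u p (L u p)" if VI: "solves_VI a l \<psi> Vh Qh u p" for u p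
  proof -
    have u: "u \<in> Vh" and p: "p \<in> Qh" using VI by (auto simp: solves_VI_def)
    note Lup = L_in[OF u p]
    have ineq: "E u p (\<lambda>x. v x - u x) - l2_inner \<Omega> (L u p) (\<lambda>x. q x - p x) + \<psi> q - \<psi> p \<ge> l (\<lambda>x. v x - u x)"
      if "v \<in> Vh" "q \<in> Qh" for v q
    proof -
      have "a (u, p) (\<lambda>x. v x - u x, \<lambda>x. q x - p x) + \<psi> q - \<psi> p \<ge> l (\<lambda>x. v x - u x)"
        using VI that unfolding solves_VI_def by blast
      then show ?thesis
        using a_eq[OF u p V(4)[OF that(1) u] Q(4)[OF that(2) p]] by simp
    qed
    have E_eq_l: "E u p w = l w" if w: "w \<in> Vh" for w
    proof -
      have "c * E u p w \<ge> c * l w" for c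
        using ineq[OF V(2)[OF u V(3)[OF w]] p, of c] E_scale[OF u p w, of c] l_scale[OF w, of c]
        by (simp add: l2_inner_def)
      from this[of 1] this[of "- 1"] show ?thesis by simp
    qed
    have \<psi>_ineq: "l2_inner \<Omega> (L u p) q - l2_inner \<Omega> (L u p) p \<le> \<psi> q - \<psi> p" if "q \<in> Qh" for q
      using ineq[OF u that] E0[OF u p] l0 inner_diff(2)[OF that p Lup] by simp
    \<comment> \<open>test with \<open>q = 0\<close> and \<open>q = 2 p\<close>\<close>
    have \<psi>_p: "l2_inner \<Omega> (L u p) p = \<psi> p"
      using \<psi>_ineq[OF Q(1)] \<psi>_ineq[OF Q(3)[OF p, of 2]] \<psi>_scale[of 0 p] \<psi>_scale[of 2 p]
        l2_inner_scaleR_right[of \<Omega> "L u p" 2 p] l2_inner_scaleR_right[of \<Omega> "L u p" 0 p]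
      by simp
    have "L u p \<in> \<Lambda>"
      using Lup \<psi>_ineq \<psi>_p by (simp add: \<Lambda>_def Lambda_hp_def)
    moreover have "l2_inner \<Omega> (\<lambda>x. \<mu> x - L u p x) p \<le> 0" if "\<mu> \<in> \<Lambda>" for \<mu>
      using that inner_diff(1)[OF _ Lup p, of \<mu>] p \<psi>_p by (auto simp: \<Lambda>_def Lambda_hp_def)
    ultimately show ?thesis
      using u p a_eq[OF u p] E_eq_l by (simp add: solves_mixed_def)
  qed
  \<comment> \<open>The equation for \<open>v = 0\<close> identifies \<open>lam\<close> with \<open>L u p\<close>; comparing \<open>lam\<close> with the multiplier that
    attains \<open>\<psi> p\<close> gives the equality on which the inequality rests.\<close>
  have mixed_imp_VI: "solves_VI a l \<psi> Vh Qh u p \<and> (AE x in lebesgue_on \<Omega>. lam x = L u p x)"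
    if M: "solves_mixed \<Omega> a l Vh Qh \<Lambda> u p lam" for u p lam
  proof -
    have u: "u \<in> Vh" and p: "p \<in> Qh" and lam: "lam \<in> Qh"
      and lam_le: "\<And>q. q \<in> Qh \<Longrightarrow> l2_inner \<Omega> lam q \<le> \<psi> q"
      using M by (auto simp: solves_mixed_def \<Lambda>_def Lambda_hp_def)
    note Lup = L_in[OF u p]
    have eq: "E u p v - l2_inner \<Omega> (L u p) q + l2_inner \<Omega> lam q = l v" if "v \<in> Vh" "q \<in> Qh" for v q
    proof -
      have "a (u, p) (v, q) + l2_inner \<Omega> lam q = l v"
        using M that unfolding solves_mixed_def by blast
      then show ?thesis using a_eq[OF u p that] by simp
    qed
    have lam_L: "l2_inner \<Omega> lam q = l2_inner \<Omega> (L u p) q" if "q \<in> Qh" for q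
      using eq[OF V(1) that] E0[OF u p] l0 by simp
    have E_eq_l: "E u p v = l v" if "v \<in> Vh" for v
      using eq[OF that Q(1)] lam_L[OF Q(1)] by simp
    obtain \<mu> where \<mu>: "\<mu> \<in> \<Lambda>" "l2_inner \<Omega> \<mu> p = \<psi> p"
      using Lambda_hp_attains_psi_hp[OF \<Omega>(1) mesh gauss assms(8), of p] p
      unfolding \<Lambda>_def Qh_def \<psi>_def by blast
    have "l2_inner \<Omega> (\<lambda>x. \<mu> x - lam x) p \<le> 0"
      using M \<mu>(1) by (auto simp: solves_mixed_def)
    then have \<psi>_p: "l2_inner \<Omega> lam p = \<psi> p"
      using inner_diff(1)[OF _ lam p, of \<mu>] \<mu> lam_le[OF p] by (auto simp: \<Lambda>_def Lambda_hp_def)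
    have "a (u, p) (\<lambda>x. v x - u x, \<lambda>x. q x - p x) + \<psi> q - \<psi> p \<ge> l (\<lambda>x. v x - u x)"
      if "v \<in> Vh" "q \<in> Qh" for v q
      using a_eq[OF u p V(4)[OF that(1) u] Q(4)[OF that(2) p]] E_eq_l[OF V(4)[OF that(1) u]]
        inner_diff(2)[OF that(2) p Lup] lam_L[OF that(2)] lam_L[OF p] lam_le[OF that(2)] \<psi>_p
      by simp
    then have "solves_VI a l \<psi> Vh Qh u p"
      using u p by (simp add: solves_VI_def)
    moreover have "AE x in lebesgue_on \<Omega>. lam x = L u p x"
    proof -
      let ?d = "\<lambda>x. lam x - L u p x"
      have d: "?d \<in> Qh" by (rule Q(4)[OF lam Lup])
      have "l2_inner \<Omega> ?d ?d = 0"
        using inner_diff(1)[OF lam Lup d] lam_L[OF d] by simp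
      then have "AE x in lebesgue_on \<Omega>. ?d x = 0"
        using l2_inner_self_eq_0_iff[OF QL2[OF d]] by simp
      then show ?thesis by simp
    qed
    ultimately show ?thesis ..
  qed
  show ?thesis
    unfolding Let_def
    using VI_imp_mixed mixed_imp_VI
    unfolding Vh_def Qh_def a_def l_def \<psi>_def \<Lambda>_def L_def by blast
qed

end
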